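(* Let $N > 0$ and $0 \leqslant n_0 < n_1 < \cdots < n_{N-1}$ be integers, and for each integer $M > n_{N-1}$, let $\epsilon_M \in \{-1,0,+1\}$ be a sign. Let $0 < \rho < +\infty$, and let $c_{n_0},\dots,c_{n_{N-1}}$ be positive reals. Then there exists a convergent power series $$f(x) = c_{n_0} x^{n_0} + c_{n_1} x^{n_1} + \dots + c_{n_{N-1}} x^{n_{N-1}} + \sum_{M > n_{N-1}} c_M x^M$$ on $(0,\rho)$ (with real coefficients) that preserves total non-negativity on $\mathrm{HTN}_N((0,\rho))$ when applied entrywise, such that for each integer $M > n_{N-1}$, $c_M$ has the sign of $\epsilon_M$ (negative, zero, or positive according as $\epsilon_M=-1,0,+1$).
   Context: A real matrix is totally non-negative if all its minors are non-negative. For $I \subset [0,+\infty)$, $\mathrm{HTN}_N(I)$ is the set of $N\times N$ Hankel totally non-negative matrices with entries in $I$. A function $f$ preserves total non-negativity on $\mathrm{HTN}_N(I)$ when applied entrywise if $f[A] := (f(a_{jk}))$ is totally non-negative for every $A=(a_{jk}) \in \mathrm{HTN}_N(I)$. *)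

theory Defs
  imports Complex_Main "Jordan_Normal_Form.Determinant" "Jordan_Normal_Form.DL_Submatrix"
begin

definition totally_nonneg :: "real mat \<Rightarrow> bool" where
  "totally_nonneg A \<longleftrightarrow>
     (\<forall>R C. R \<subseteq> {..<dim_row A} \<and> C \<subseteq> {..<dim_col A} \<and> card R = card C \<longrightarrow>
        det (submatrix A R C) \<ge> 0)"

definition hankel :: "'a mat \<Rightarrow> bool" where
  "hankel A \<longleftrightarrow>
     (\<forall>i < dim_row A. \<forall>j < dim_col A. \<forall>k < dim_row A. \<forall>l < dim_col A.
        i + j = k + l \<longrightarrow> A $$ (i, j) = A $$ (k, l))"

definition HTN :: "nat \<Rightarrow> real set \<Rightarrow> real mat set" where
  "HTN N I = {A \<in> carrier_mat N N. hankel A \<and> totally_nonneg A \<and> elements_mat A \<subseteq> I}"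

definition preserves_HTN :: "(real \<Rightarrow> real) \<Rightarrow> nat \<Rightarrow> real set \<Rightarrow> bool" where
  "preserves_HTN f N I \<longleftrightarrow> (\<forall>A \<in> HTN N I. totally_nonneg (map_mat f A))"

end

theory Submission
  imports Defs "HOL-Analysis.Convex"
begin

text \<open>
  The proof rests on two facts.

  A Hankel matrix is totally non-negative if and only if it and the matrix obtained from it by
  deleting the first row and the last column are positive semidefinite
  (\<open>hankel_totally_nonneg_iff\<close>). One direction is the criterion that a symmetric matrix with
  non-negative principal minors is positive semidefinite. For the other, the contiguous minors of a
  Hankel matrix are principal minors of these two matrices, hence positive in the positive definite
  case; Fekete's criterion (\<open>fekete_symmetric\<close>) extends this to all minors, and a perturbation by the
  Hankel matrix of a moment sequence removes definiteness. As functions act entrywise, it is enough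
  that \<open>f\<close> preserves positive semidefiniteness.

  The second fact (\<open>power_domination\<close>) is that \<open>N\<close> lower powers with positive coefficients dominate
  every higher power: for some \<open>\<delta> > 0\<close> the function \<open>\<Sum>k\<in>E. c k * x ^ k - \<delta> * x ^ M\<close> preserves
  positive semidefiniteness of matrices of size at most \<open>N\<close> with entries between 0 and \<open>\<rho>\<close>. For
  matrices of rank one this says that the interpolation of \<open>x ^ M\<close> by the powers in \<open>E\<close>, at any \<open>N\<close>
  points of a bounded positive interval, has coefficients bounded independently of the points
  (\<open>fewnomial_coeff_bound\<close>), which follows by iterating Rolle's theorem. The general case follows by
  the method of FitzGerald and Horn, integrating from a rank one matrix along a segment and using the
  Schur product theorem and induction on the size.

  Finally (\<open>power_series_psd\<close>) the polynomial \<open>\<Sum>k\<in>E. c k * x ^ k\<close> is distributed among the higher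
  powers \<open>x ^ M\<close> with weights \<open>(1/2) ^ (M + 1)\<close>, of total at most 1. The share of \<open>x ^ M\<close> permits a
  coefficient of either sign, provided that it is small, and small coefficients also give convergence.
\<close>

section \<open>Combinations of few powers\<close>

text \<open>
  Induction on the number of zeros: the largest zero is removed, and the derivative zeros found for the
  others stay below the second largest one, so the zero of the derivative between the two largest is new.
\<close>
lemma rolle_finite:
  fixes g g' :: "real \<Rightarrow> real"
  assumes der: "\<And>x. x > 0 \<Longrightarrow> (g has_real_derivative g' x) (at x)"
  assumes "finite X" "card X = Suc m" "X \<subseteq> {0<..}" "\<And>x. x \<in> X \<Longrightarrow> g x = 0"
  shows "\<exists>Y. finite Y \<and> card Y = m \<and> Y \<subseteq> {0<..<Max X} \<and> (\<forall>y\<in>Y. g' y = 0)"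
  using assms(2-5)
proof (induction m arbitrary: X)
  case 0
  then show ?case by (intro exI[of _ "{}"]) auto
next
  case (Suc m)
  define b where "b = Max X"
  define X0 where "X0 = X - {b}"
  have ne: "X \<noteq> {}" using Suc.prems(2) by (metis card.empty nat.distinct(1))
  have bX: "b \<in> X" unfolding b_def using Suc.prems ne by (intro Max_in) auto
  have cX0: "card X0 = Suc m" "finite X0" using Suc.prems bX by (auto simp: X0_def)
  then have ne0: "X0 \<noteq> {}" by auto
  define a where "a = Max X0"
  have aX0: "a \<in> X0" unfolding a_def using cX0 ne0 by (intro Max_in) auto
  have a_pos: "a > 0" using aX0 Suc.prems X0_def by auto
  have "a \<le> b" unfolding b_def using aX0 Suc.prems by (intro Max_ge) (auto simp: X0_def)
  then have ab: "a < b" using aX0 X0_def by (metis DiffE insertI1 order_le_less)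
  obtain Y where Y: "finite Y" "card Y = m" "Y \<subseteq> {0<..<a}" "\<forall>y\<in>Y. g' y = 0"
    using Suc.IH[of X0] cX0 Suc.prems unfolding a_def X0_def by auto
  have dg: "g a = 0" "g b = 0" using aX0 bX Suc.prems X0_def by auto
  have "\<exists>z. a < z \<and> z < b \<and> (\<lambda>h. g' z * h) = (\<lambda>v. 0)"
  proof (rule Rolle_deriv[OF ab, where f = g and f' = "\<lambda>x h. g' x * h"])
    show "g a = g b" using dg by simp
    show "continuous_on {a..b} g"
      by (rule DERIV_continuous_on[where D = g'], rule has_field_derivative_at_within, rule der)
        (use a_pos in auto)
    show "(g has_derivative (\<lambda>h. g' x * h)) (at x)" if "a < x" "x < b" for x
      using der[of x] that a_pos by (auto simp: has_field_derivative_def)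
  qed
  then obtain z where z: "a < z" "z < b" "(\<lambda>h. g' z * h) = (\<lambda>v. 0)" by blast
  have gz: "g' z = 0" using fun_cong[OF z(3), of 1] by simp
  have "z \<notin> Y" using Y z by auto
  then have "card (insert z Y) = Suc m" using Y by simp
  moreover have "insert z Y \<subseteq> {0<..<b}" using Y z a_pos ab by auto
  ultimately show ?case using Y gz by (intro exI[of _ "insert z Y"]) (auto simp: b_def)
qed

text \<open>
  The bound is homogeneous in \<open>\<alpha>\<close>: taking \<open>\<alpha> = 0\<close> turns it into the statement that a nonzero
  combination of \<open>card E\<close> powers has fewer than \<open>card E\<close> zeros in the interval.
\<close>
definition coeff_bound :: "nat set \<Rightarrow> nat \<Rightarrow> real \<Rightarrow> real \<Rightarrow> bool" where
  "coeff_bound E M R K \<longleftrightarrow> K \<ge> 0 \<and>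
     (\<forall>X \<alpha> \<beta>. finite X \<longrightarrow> card X = card E \<longrightarrow> X \<subseteq> {0<..R} \<longrightarrow>
        (\<forall>x\<in>X. \<alpha> * x ^ M = (\<Sum>k\<in>E. \<beta> k * x ^ k)) \<longrightarrow> (\<forall>k\<in>E. \<bar>\<beta> k\<bar> \<le> K * \<bar>\<alpha>\<bar>))"

lemma coeff_boundD:
  assumes "coeff_bound E M R K" "finite X" "card X = card E" "X \<subseteq> {0<..R}"
    and "\<And>x. x \<in> X \<Longrightarrow> \<alpha> * x ^ M = (\<Sum>k\<in>E. \<beta> k * x ^ k)" and "k \<in> E"
  shows "\<bar>\<beta> k\<bar> \<le> K * \<bar>\<alpha>\<bar>"
  using assms unfolding coeff_bound_def by meson

text \<open>
  The point is that \<open>K\<close> does not depend on \<open>X\<close>, whose points may collide or approach 0. Dividing the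
  relation by \<open>x ^ Min E\<close> and differentiating removes the lowest power and, by Rolle, costs one point;
  this bounds all other coefficients by induction. The lowest coefficient is then read off from the
  relation at any single point of \<open>X\<close>.
\<close>
lemma fewnomial_coeff_bound:
  fixes R :: real
  assumes "finite E" "card E = m" "\<And>k. k \<in> E \<Longrightarrow> k < M"
  shows "\<exists>K. coeff_bound E M R K"
  using assms
proof (induction m arbitrary: E M)
  case 0
  then show ?case by (auto simp: coeff_bound_def)
next
  case (Suc m)
  have ne: "E \<noteq> {}" using Suc.prems by auto
  define e where "e = Min E"
  define E1 where "E1 = E - {e}"
  have eE: "e \<in> E" unfolding e_def using Suc.prems ne by (intro Min_in) auto
  have finE1: "finite E1" and cE1: "card E1 = m" using Suc.prems eE by (auto simp: E1_def)
  have E_eq: "E = insert e E1" "e \<notin> E1" using eE by (auto simp: E1_def)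
  have gt: "e < k" if "k \<in> E1" for k
  proof -
    have "e \<le> k" unfolding e_def using that Suc.prems by (intro Min_le) (auto simp: E1_def)
    then show ?thesis using that by (auto simp: E1_def order_le_less)
  qed
  have eM: "e < M" using Suc.prems eE by auto
  define sh where "sh k = k - e - 1" for k :: nat
  have inj: "inj_on sh E1"
  proof (rule inj_onI)
    fix x y assume "x \<in> E1" "y \<in> E1" "sh x = sh y"
    then show "x = y" using gt[of x] gt[of y] unfolding sh_def by linarith
  qed
  have c1: "finite (sh ` E1)" "card (sh ` E1) = m" using finE1 cE1 inj by (auto simp: card_image)
  have lt1: "k < sh M" if ki: "k \<in> sh ` E1" for k
  proof -
    obtain i where i: "i \<in> E1" "k = sh i" using ki by auto
    then have "e < i" "i < M" using gt Suc.prems(3) by (auto simp: E1_def)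
    then show ?thesis unfolding i(2) sh_def by linarith
  qed
  obtain K where K: "coeff_bound (sh ` E1) (sh M) R K" using Suc.IH[OF c1 lt1] by auto
  define K1 where "K1 = K * real (M - e)"
  define K2 where "K2 = \<bar>R\<bar> ^ (M - e) + (\<Sum>k\<in>E1. K1 * \<bar>R\<bar> ^ (k - e))"
  have K1: "K1 \<ge> 0" unfolding K1_def using K by (simp add: coeff_bound_def)
  have K2: "K2 \<ge> 0" unfolding K2_def using K1 by (intro add_nonneg_nonneg sum_nonneg) auto
  have "\<bar>\<beta> k\<bar> \<le> (K1 + K2) * \<bar>\<alpha>\<bar>"
    if X: "finite X" "card X = card E" "X \<subseteq> {0<..R}"
      and eq: "\<forall>x\<in>X. \<alpha> * x ^ M = (\<Sum>k\<in>E. \<beta> k * x ^ k)" and kE: "k \<in> E"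
    for X \<alpha> \<beta> k
  proof -
    define g where "g x = \<alpha> * x ^ (M - e) - (\<Sum>k\<in>E. \<beta> k * x ^ (k - e))" for x :: real
    define g' where "g' x = \<alpha> * (real (M - e) * x ^ (M - e - 1))
        - (\<Sum>k\<in>E. \<beta> k * (real (k - e) * x ^ (k - e - 1)))" for x :: real
    have der: "(g has_real_derivative g' x) (at x)" for x
      unfolding g_def[abs_def] g'_def by (auto intro!: derivative_eq_intros simp: mult_ac)
    have g0: "g x = 0" if "x \<in> X" for x
    proof -
      have x: "x > 0" using that X by auto
      have "x ^ e * g x = \<alpha> * (x ^ e * x ^ (M - e)) - (\<Sum>k\<in>E. \<beta> k * (x ^ e * x ^ (k - e)))"
        by (simp add: g_def algebra_simps sum_distrib_left)
      also have "\<dots> = \<alpha> * x ^ M - (\<Sum>k\<in>E. \<beta> k * x ^ k)"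
        using eM gt E_eq by (intro arg_cong2[of _ _ _ _ "(-)"] sum.cong)
          (auto simp flip: power_add simp: less_imp_le)
      also have "\<dots> = 0" using eq that by simp
      finally show ?thesis using x by simp
    qed
    obtain Y where Y: "finite Y" "card Y = m" "Y \<subseteq> {0<..<Max X}" "\<forall>y\<in>Y. g' y = 0"
      using rolle_finite[of g g' X m] der X g0 Suc.prems(2) by fastforce
    have ne: "X \<noteq> {}" using X(2) Suc.prems(2) by auto
    then have "Max X \<le> R" using X by (meson Max_in greaterThanAtMost_iff subsetD)
    then have Y2: "Y \<subseteq> {0<..R}" using Y by auto
    have "\<forall>y\<in>Y. (\<alpha> * real (M - e)) * y ^ sh M =
        (\<Sum>k\<in>sh ` E1. (\<beta> (k + e + 1) * real (k + 1)) * y ^ k)"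
    proof
      fix y assume "y \<in> Y"
      then have "\<alpha> * (real (M - e) * y ^ (M - e - 1))
        = (\<Sum>k\<in>E. \<beta> k * (real (k - e) * y ^ (k - e - 1)))" using Y by (auto simp: g'_def)
      also have "\<dots> = (\<Sum>k\<in>E1. \<beta> k * (real (k - e) * y ^ (k - e - 1)))"
        using E_eq finE1 by simp
      also have "\<dots> = (\<Sum>k\<in>E1. (\<beta> (sh k + e + 1) * real (sh k + 1)) * y ^ sh k)"
        by (intro sum.cong) (use gt in \<open>auto simp: sh_def Suc_diff_Suc\<close>)
      also have "\<dots> = (\<Sum>k\<in>sh ` E1. (\<beta> (k + e + 1) * real (k + 1)) * y ^ k)"
        by (simp add: sum.reindex[OF inj])
      finally show "(\<alpha> * real (M - e)) * y ^ sh M =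
        (\<Sum>k\<in>sh ` E1. (\<beta> (k + e + 1) * real (k + 1)) * y ^ k)" by (simp add: sh_def mult.assoc)
    qed
    then have b: "\<bar>\<beta> (k + e + 1) * real (k + 1)\<bar> \<le> K * \<bar>\<alpha> * real (M - e)\<bar>" if "k \<in> sh ` E1" for k
      using coeff_boundD[OF K Y(1) _ Y2 _ that, where \<beta> = "\<lambda>k. \<beta> (k + e + 1) * real (k + 1)"] Y(2) c1(2)
      by auto
    have b1: "\<bar>\<beta> k\<bar> \<le> K1 * \<bar>\<alpha>\<bar>" if "k \<in> E1" for k
    proof -
      have k: "sh k + e + 1 = k" using gt[OF that] by (auto simp: sh_def)
      have "\<bar>\<beta> k\<bar> * 1 \<le> \<bar>\<beta> k\<bar> * real (sh k + 1)" by (intro mult_left_mono) auto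
      also have "\<dots> \<le> K * \<bar>\<alpha> * real (M - e)\<bar>"
        using b[of "sh k"] that unfolding k by (simp add: abs_mult)
      finally show ?thesis by (simp add: K1_def abs_mult mult_ac)
    qed
    obtain x where x: "x \<in> X" using ne by auto
    then have xR: "0 < x" "x \<le> R" using X by auto
    have "\<beta> e = \<alpha> * x ^ (M - e) - (\<Sum>k\<in>E1. \<beta> k * x ^ (k - e))"
      using g0[OF x] E_eq finE1 by (simp add: g_def)
    also have "\<bar>\<dots>\<bar> \<le> \<bar>\<alpha> * x ^ (M - e)\<bar> + (\<Sum>k\<in>E1. \<bar>\<beta> k * x ^ (k - e)\<bar>)"
      by (rule order_trans[OF abs_triangle_ineq4]) (intro add_mono order_refl sum_abs)
    also have "\<dots> \<le> \<bar>\<alpha>\<bar> * \<bar>R\<bar> ^ (M - e) + (\<Sum>k\<in>E1. (K1 * \<bar>\<alpha>\<bar>) * \<bar>R\<bar> ^ (k - e))"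
      unfolding abs_mult power_abs
      by (intro add_mono sum_mono mult_mono power_mono b1) (use xR K1 in auto)
    also have "\<dots> = K2 * \<bar>\<alpha>\<bar>" by (simp add: K2_def algebra_simps sum_distrib_left)
    finally have be: "\<bar>\<beta> e\<bar> \<le> K2 * \<bar>\<alpha>\<bar>" .
    have "K1 * \<bar>\<alpha>\<bar> \<le> (K1 + K2) * \<bar>\<alpha>\<bar>" "K2 * \<bar>\<alpha>\<bar> \<le> (K1 + K2) * \<bar>\<alpha>\<bar>"
      using K1 K2 by (auto intro!: mult_right_mono)
    then show ?thesis using kE be b1 E_eq by (metis insertE order_trans)
  qed
  then have "coeff_bound E M R (K1 + K2)"
    unfolding coeff_bound_def by (intro conjI allI impI ballI add_nonneg_nonneg K1 K2)
  then show ?case by blast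
qed

lemma fewnomial_zero:
  fixes b :: "nat \<Rightarrow> real"
  assumes "finite E" "finite X" "card X = card E" "X \<subseteq> {0<..}"
    and "\<And>x. x \<in> X \<Longrightarrow> (\<Sum>k\<in>E. b k * x ^ k) = 0" and "k \<in> E"
  shows "b k = 0"
proof -
  define R where "R = Max X"
  have XR: "X \<subseteq> {0<..R}" using assms by (auto simp: R_def)
  obtain M where M: "\<And>k. k \<in> E \<Longrightarrow> k < M"
    using assms(1) by (metis finite_nat_set_iff_bounded)
  have z: "\<forall>x\<in>X. 0 * x ^ M = (\<Sum>k\<in>E. b k * x ^ k)" using assms by simp
  obtain K where K: "coeff_bound E M R K" using fewnomial_coeff_bound[OF assms(1) refl M] by blast
  have "\<bar>b k\<bar> \<le> K * \<bar>0\<bar>" using assms z by (intro coeff_boundD[OF K assms(2,3) XR]) auto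
  then show ?thesis by simp
qed

text \<open>
  When a point \<open>x0\<close> and an exponent \<open>e\<close> are added, an interpolant is corrected by a multiple of the
  combination \<open>q\<close> with leading term \<open>x ^ e\<close> that vanishes at the old points; \<open>q x0\<close> is nonzero because
  \<open>q\<close> has too few terms to vanish at all points.
\<close>
lemma fewnomial_interpolation:
  fixes t :: "real \<Rightarrow> real"
  assumes "finite X" "X \<subseteq> {0<..}" "finite E" "card E = card X"
  shows "\<exists>\<beta>. \<forall>x\<in>X. t x = (\<Sum>k\<in>E. \<beta> k * x ^ k)"
  using assms
proof (induction X arbitrary: E t rule: finite_induct)
  case empty
  then show ?case by auto
next
  case (insert x0 X)
  then have "card E = Suc (card X)" by simp
  then obtain e where e: "e \<in> E" by (metis card.empty equals0I nat.distinct(1))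
  define E0 where "E0 = E - {e}"
  have E0: "finite E0" "card E0 = card X" "E = insert e E0" "e \<notin> E0"
    using insert e by (auto simp: E0_def)
  have Xp: "X \<subseteq> {0<..}" using insert by auto
  obtain \<beta> where \<beta>: "\<forall>x\<in>X. t x = (\<Sum>k\<in>E0. \<beta> k * x ^ k)"
    using insert.IH[OF Xp E0(1,2), of t] by blast
  obtain \<gamma> where \<gamma>: "\<forall>x\<in>X. x ^ e = (\<Sum>k\<in>E0. \<gamma> k * x ^ k)"
    using insert.IH[OF Xp E0(1,2), of "\<lambda>x. x ^ e"] by blast
  define q where "q x = x ^ e - (\<Sum>k\<in>E0. \<gamma> k * x ^ k)" for x :: real
  define d where "d k = (if k = e then 1 else - \<gamma> k)" for k
  have qd: "q x = (\<Sum>k\<in>E. d k * x ^ k)" for x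
  proof -
    have "(\<Sum>k\<in>E0. d k * x ^ k) = (\<Sum>k\<in>E0. - (\<gamma> k * x ^ k))"
      using E0 by (intro sum.cong) (auto simp: d_def)
    then show ?thesis using E0 by (simp add: q_def d_def sum_negf)
  qed
  have q0: "q x = 0" if "x \<in> X" for x using \<gamma> that by (simp add: q_def)
  have "q x0 \<noteq> 0"
  proof
    assume "q x0 = 0"
    then have "(\<Sum>k\<in>E. d k * x ^ k) = 0" if "x \<in> insert x0 X" for x
      using that q0 unfolding qd by auto
    then have "d e = 0"
      using insert.prems insert.hyps e by (intro fewnomial_zero[of E "insert x0 X" d e]) auto
    then show False by (simp add: d_def)
  qed
  define s where "s = (t x0 - (\<Sum>k\<in>E0. \<beta> k * x0 ^ k)) / q x0"
  define \<beta>' where "\<beta>' k = (if k = e then 0 else \<beta> k) + s * d k" for k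
  have "(\<Sum>k\<in>E. \<beta>' k * x ^ k) = (\<Sum>k\<in>E0. \<beta> k * x ^ k) + s * q x" for x
  proof -
    have "(\<Sum>k\<in>E. \<beta>' k * x ^ k) = (\<Sum>k\<in>E. (if k = e then 0 else \<beta> k) * x ^ k) + s * q x"
      unfolding qd by (simp add: \<beta>'_def algebra_simps sum.distrib sum_distrib_left)
    also have "(\<Sum>k\<in>E. (if k = e then 0 else \<beta> k) * x ^ k) = (\<Sum>k\<in>E0. \<beta> k * x ^ k)"
      using E0 by (simp, intro sum.cong, auto)
    finally show ?thesis .
  qed
  then have "\<forall>x\<in>insert x0 X. t x = (\<Sum>k\<in>E. \<beta>' k * x ^ k)"
    using \<beta> q0 \<open>q x0 \<noteq> 0\<close> by (simp add: s_def)
  then show ?case by blast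
qed

text \<open>
  Fewer points than exponents are allowed: further points are added before interpolating.
\<close>
lemma bounded_interpolation:
  fixes R :: real
  assumes "R > 0" "finite E" "\<And>k. k \<in> E \<Longrightarrow> k < M"
  shows "\<exists>K\<ge>0. \<forall>X. finite X \<longrightarrow> card X \<le> card E \<longrightarrow> X \<subseteq> {0<..R} \<longrightarrow>
           (\<exists>\<beta>. (\<forall>x\<in>X. x ^ M = (\<Sum>k\<in>E. \<beta> k * x ^ k)) \<and> (\<forall>k\<in>E. \<bar>\<beta> k\<bar> \<le> K))"
proof -
  obtain K where K: "coeff_bound E M R K" using fewnomial_coeff_bound[OF assms(2) refl assms(3)] by blast
  have "\<exists>\<beta>. (\<forall>x\<in>X. x ^ M = (\<Sum>k\<in>E. \<beta> k * x ^ k)) \<and> (\<forall>k\<in>E. \<bar>\<beta> k\<bar> \<le> K)"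
    if X: "finite X" "card X \<le> card E" "X \<subseteq> {0<..R}" for X
  proof -
    have "infinite ({0<..R} - X)" using assms(1) X(1) by (simp add: infinite_Ioc)
    then obtain Z where Z: "finite Z" "card Z = card E - card X" "Z \<subseteq> {0<..R} - X"
      by (meson infinite_arbitrarily_large)
    have "X \<inter> Z = {}" using Z by auto
    then have "card (X \<union> Z) = card E" using X Z by (simp add: card_Un_disjoint)
    then have cXZ: "finite (X \<union> Z)" "card (X \<union> Z) = card E" "X \<union> Z \<subseteq> {0<..R}"
      using X Z by auto
    obtain \<beta> where \<beta>: "\<forall>x\<in>X \<union> Z. x ^ M = (\<Sum>k\<in>E. \<beta> k * x ^ k)"
      using fewnomial_interpolation[of "X \<union> Z" E "\<lambda>x. x ^ M"] cXZ assms(2) by fastforce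
    then have "\<forall>k\<in>E. \<bar>\<beta> k\<bar> \<le> K" using coeff_boundD[OF K cXZ, of 1 \<beta>] by simp
    then show ?thesis using \<beta> by auto
  qed
  then show ?thesis using K unfolding coeff_bound_def by blast
qed

section \<open>Domination of a power on rank one matrices\<close>

text \<open>
  This is the rank one case of the domination theorem. Interpolating \<open>x ^ M\<close> by the powers in \<open>E\<close> at
  the numbers \<open>u i\<close> writes \<open>\<Sum>i. v i * u i ^ M\<close> as a combination of the sums
  \<open>\<Sum>i. v i * u i ^ k\<close> with coefficients bounded independently of \<open>u\<close> and \<open>v\<close>, and Cauchy--Schwarz
  finishes.
\<close>
lemma rank_one_domination:
  fixes R :: real and c :: "nat \<Rightarrow> real"
  assumes "R > 0" "finite E" "m \<le> card E" "\<And>k. k \<in> E \<Longrightarrow> k < M" "\<And>k. k \<in> E \<Longrightarrow> c k > 0"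
  shows "\<exists>\<delta>>0. \<forall>u v. (\<forall>i<m. u i \<in> {0<..R}) \<longrightarrow>
           \<delta> * (\<Sum>i<m. v i * u i ^ M)\<^sup>2 \<le> (\<Sum>k\<in>E. c k * (\<Sum>i<m. v i * u i ^ k)\<^sup>2)"
proof -
  obtain K where K: "K \<ge> 0" "\<forall>X. finite X \<longrightarrow> card X \<le> card E \<longrightarrow> X \<subseteq> {0<..R} \<longrightarrow>
           (\<exists>\<beta>. (\<forall>x\<in>X. x ^ M = (\<Sum>k\<in>E. \<beta> k * x ^ k)) \<and> (\<forall>k\<in>E. \<bar>\<beta> k\<bar> \<le> K))"
    using bounded_interpolation[OF assms(1,2,4)] by auto
  (* The 1 only keeps the minimum defined when E is empty. *)
  define \<mu> where "\<mu> = Min (insert 1 (c ` E))"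
  have \<mu>: "\<mu> > 0" "\<And>k. k \<in> E \<Longrightarrow> \<mu> \<le> c k" using assms(2,5) by (auto simp: \<mu>_def)
  define L where "L = K\<^sup>2 * real (card E)"
  define \<delta> where "\<delta> = \<mu> / (L + 1)"
  have L: "L \<ge> 0" by (simp add: L_def)
  have \<delta>: "\<delta> > 0" "\<delta> * L \<le> \<mu>" using \<mu> L by (auto simp: \<delta>_def field_simps)
  have "\<delta> * (\<Sum>i<m. v i * u i ^ M)\<^sup>2 \<le> (\<Sum>k\<in>E. c k * (\<Sum>i<m. v i * u i ^ k)\<^sup>2)"
    if u: "\<forall>i<m. u i \<in> {0<..R}" for u v :: "nat \<Rightarrow> real"
  proof -
    have "card (u ` {..<m}) \<le> card E" using card_image_le[of "{..<m}" u] assms(3) by simp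
    moreover have "u ` {..<m} \<subseteq> {0<..R}" using u by auto
    ultimately obtain \<beta> where \<beta>: "\<forall>x\<in>u ` {..<m}. x ^ M = (\<Sum>k\<in>E. \<beta> k * x ^ k)"
      and bK: "\<forall>k\<in>E. \<bar>\<beta> k\<bar> \<le> K" using K(2) by (meson finite_imageI finite_lessThan)
    define s where "s k = (\<Sum>i<m. v i * u i ^ k)" for k
    have "s M = (\<Sum>i<m. \<Sum>k\<in>E. \<beta> k * (v i * u i ^ k))"
      unfolding s_def using \<beta> by (intro sum.cong) (auto simp: sum_distrib_left mult_ac)
    also have "\<dots> = (\<Sum>k\<in>E. \<beta> k * s k)"
      by (subst sum.swap) (simp add: s_def sum_distrib_left)
    finally have "(s M)\<^sup>2 \<le> (\<Sum>k\<in>E. (\<beta> k * s k)\<^sup>2) * real (card E)"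
      using sum_squared_le_sum_of_squares[of "\<lambda>k. \<beta> k * s k" E] by simp
    also have "\<dots> \<le> (\<Sum>k\<in>E. K\<^sup>2 * (s k)\<^sup>2) * real (card E)"
    proof (intro mult_right_mono sum_mono)
      fix k assume "k \<in> E"
      then have "(\<beta> k)\<^sup>2 \<le> K\<^sup>2" using bK K(1) by (simp add: abs_le_square_iff[symmetric])
      then show "(\<beta> k * s k)\<^sup>2 \<le> K\<^sup>2 * (s k)\<^sup>2"
        by (simp add: power_mult_distrib mult_right_mono)
    qed simp
    also have "\<dots> = L * (\<Sum>k\<in>E. (s k)\<^sup>2)" by (simp add: L_def sum_distrib_left mult_ac)
    finally have "\<delta> * (s M)\<^sup>2 \<le> \<delta> * L * (\<Sum>k\<in>E. (s k)\<^sup>2)" using \<delta>(1) by simp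
    also have "\<dots> \<le> \<mu> * (\<Sum>k\<in>E. (s k)\<^sup>2)" by (intro mult_right_mono \<delta> sum_nonneg) simp
    also have "\<dots> \<le> (\<Sum>k\<in>E. c k * (s k)\<^sup>2)"
      unfolding sum_distrib_left by (intro sum_mono mult_right_mono \<mu>) auto
    finally show ?thesis by (simp add: s_def)
  qed
  then show ?thesis using \<delta>(1) by blast
qed

section \<open>Positive semidefinite matrices and Schur products\<close>

text \<open>
  Square matrices are functions on pairs of indices together with a size, so that induction on the
  size and the passage to corner blocks need no conversions.
\<close>
definition quad :: "nat \<Rightarrow> (nat \<Rightarrow> nat \<Rightarrow> real) \<Rightarrow> (nat \<Rightarrow> real) \<Rightarrow> real" where
  "quad m B v = (\<Sum>i<m. \<Sum>j<m. v i * v j * B i j)"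

definition psd :: "nat \<Rightarrow> (nat \<Rightarrow> nat \<Rightarrow> real) \<Rightarrow> bool" where
  "psd m B \<longleftrightarrow> (\<forall>i<m. \<forall>j<m. B i j = B j i) \<and> (\<forall>v. 0 \<le> quad m B v)"

lemma quad_add: "quad m (\<lambda>i j. A i j + B i j) v = quad m A v + quad m B v"
  by (simp add: quad_def algebra_simps sum.distrib)

lemma quad_scale: "quad m (\<lambda>i j. a * B i j) v = a * quad m B v"
  by (simp add: quad_def sum_distrib_left mult_ac)

lemma quad_sum: "quad m (\<lambda>i j. \<Sum>k\<in>E. c k * A k i j) v = (\<Sum>k\<in>E. c k * quad m (A k) v)"
proof (induction E rule: infinite_finite_induct)
  case (insert x E)
  then show ?case by (simp add: quad_add quad_scale)
qed (simp_all add: quad_def)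

lemma psd_add: "psd m A \<Longrightarrow> psd m B \<Longrightarrow> psd m (\<lambda>i j. A i j + B i j)"
  by (simp add: psd_def quad_add)

lemma psd_scale: "psd m B \<Longrightarrow> 0 \<le> a \<Longrightarrow> psd m (\<lambda>i j. a * B i j)"
  by (simp add: psd_def quad_scale)

lemma quad_rank_one: "quad m (\<lambda>i j. u i * u j) v = (\<Sum>i<m. v i * u i)\<^sup>2"
  by (simp add: quad_def power2_eq_square sum_product mult_ac)

lemma psd_rank_one: "psd m (\<lambda>i j. u i * u j)"
  by (simp add: psd_def quad_rank_one mult.commute)

lemma quad_Suc:
  assumes "\<And>i. i < m \<Longrightarrow> B m i = B i m"
  shows "quad (Suc m) B v = quad m B v + 2 * v m * (\<Sum>i<m. v i * B i m) + (v m)\<^sup>2 * B m m"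
proof -
  have "(\<Sum>j<m. v m * v j * B m j) = v m * (\<Sum>i<m. v i * B i m)"
    using assms by (simp add: sum_distrib_left mult_ac)
  moreover have "(\<Sum>i<m. v i * v m * B i m) = v m * (\<Sum>i<m. v i * B i m)"
    by (simp add: sum_distrib_left mult_ac)
  ultimately show ?thesis
    by (simp add: quad_def sum.distrib power2_eq_square algebra_simps)
qed

lemma quad_zero_border:
  assumes "\<And>i. i \<le> m \<Longrightarrow> B m i = 0" "\<And>i. i \<le> m \<Longrightarrow> B i m = 0"
  shows "quad (Suc m) B v = quad m B v"
  using assms by (subst quad_Suc) auto

lemma psd_mono: assumes "psd m B" "k \<le> m" shows "psd k B"
proof -
  have "quad k B v = quad m B (\<lambda>i. if i < k then v i else 0)" for v
  proof -
    have "(\<Sum>i<m. \<Sum>j<m. (if i < k then v i else 0) * (if j < k then v j else 0) * B i j)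
      = (\<Sum>i<k. \<Sum>j<m. (if i < k then v i else 0) * (if j < k then v j else 0) * B i j)"
      by (rule sum.mono_neutral_right) (use assms in auto)
    also have "\<dots> = (\<Sum>i<k. \<Sum>j<k. (if i < k then v i else 0) * (if j < k then v j else 0) * B i j)"
      by (rule sum.cong[OF refl], rule sum.mono_neutral_right) (use assms in auto)
    also have "\<dots> = quad k B v" by (simp add: quad_def)
    finally show ?thesis by (simp add: quad_def)
  qed
  then show ?thesis using assms by (auto simp: psd_def)
qed

lemma sum_eq_single:
  fixes g :: "nat \<Rightarrow> real"
  assumes "i < m" "\<And>j. j < m \<Longrightarrow> j \<noteq> i \<Longrightarrow> g j = 0"
  shows "(\<Sum>j<m. g j) = g i"
  using assms by (subst sum.remove[of _ i]) auto

lemma psd_diag: assumes "psd m B" "i < m" shows "0 \<le> B i i"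
proof -
  have "quad m B (\<lambda>k. if k = i then 1 else 0) = B i i"
    unfolding quad_def using assms(2) by (simp add: sum_eq_single[of i m])
  then show ?thesis using assms by (metis psd_def)
qed

lemma quad_complete_square:
  assumes "\<And>i. i < m \<Longrightarrow> B m i = B i m" "B m m \<noteq> 0"
  shows "quad (Suc m) B v = quad m (\<lambda>i j. B i j - B i m * B j m / B m m) v
           + B m m * (v m + (\<Sum>i<m. v i * B i m) / B m m)\<^sup>2"
proof -
  define s where "s = (\<Sum>i<m. v i * B i m)"
  have "quad m (\<lambda>i j. B i j - B i m * B j m / B m m) v
      = quad m B v + quad m (\<lambda>i j. (-1 / B m m) * (B i m * B j m)) v"
    by (subst quad_add[symmetric]) simp
  also have "\<dots> = quad m B v - s\<^sup>2 / B m m"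
    unfolding quad_scale quad_rank_one s_def by simp
  finally have C: "quad m (\<lambda>i j. B i j - B i m * B j m / B m m) v = quad m B v - s\<^sup>2 / B m m" .
  have "quad (Suc m) B v = quad m B v + 2 * v m * s + (v m)\<^sup>2 * B m m"
    unfolding s_def by (rule quad_Suc) (rule assms(1))
  then show ?thesis
    unfolding C s_def[symmetric] using assms(2) by (simp add: power2_eq_square algebra_simps)
qed

lemma quad_schur_complement:
  assumes "\<And>i. i < m \<Longrightarrow> B m i = B i m" "B m m \<noteq> 0"
  shows "quad m (\<lambda>i j. B i j - B i m * B j m / B m m) v
           = quad (Suc m) B (v(m := - (\<Sum>i<m. v i * B i m) / B m m))"
proof -
  let ?w = "v(m := - (\<Sum>i<m. v i * B i m) / B m m)"
  have "(\<Sum>i<m. ?w i * B i m) = (\<Sum>i<m. v i * B i m)" by (rule sum.cong) auto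
  moreover have "quad m C ?w = quad m C v" for C by (simp add: quad_def)
  ultimately show ?thesis using assms by (subst quad_complete_square) auto
qed

lemma schur_complement_psd:
  assumes "psd (Suc m) B"
  shows "psd m (\<lambda>i j. B i j - B i m * B j m / B m m)"
proof (cases "B m m = 0")
  case True
  then show ?thesis using psd_mono[OF assms, of m] by simp
next
  case False
  have sym: "\<And>i j. i \<le> m \<Longrightarrow> j \<le> m \<Longrightarrow> B i j = B j i"
    using assms by (auto simp: psd_def less_Suc_eq_le)
  then show ?thesis
    using assms False by (auto simp: psd_def quad_schur_complement mult.commute)
qed

lemma psd_entry_square:
  assumes "psd (Suc m) B" "i < m"
  shows "(B i m)\<^sup>2 / B m m \<le> B i i"
  using psd_diag[OF schur_complement_psd[OF assms(1)] assms(2)] by (simp add: power2_eq_square)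

text \<open>
  Otherwise the test vector \<open>e\<^sub>i + t e\<^sub>m\<close> makes the form linear in \<open>t\<close> with nonzero slope.
\<close>
lemma psd_zero_diag:
  assumes "psd (Suc m) B" "B m m = 0" "i \<le> m"
  shows "B i m = 0"
proof (rule ccontr)
  assume nz: "B i m \<noteq> 0"
  then have im: "i < m" using assms by (cases "i = m") auto
  define t where "t = - (B i i + 1) / (2 * B i m)"
  define w where "w = (\<lambda>k. if k = i then 1 else if k = m then t else 0 :: real)"
  have a: "quad m B w = B i i"
    unfolding quad_def w_def using im by (simp add: sum_eq_single[of i m])
  have b: "(\<Sum>k<m. w k * B k m) = B i m"
    unfolding w_def using im by (simp add: sum_eq_single[of i m])
  have "quad (Suc m) B w = quad m B w + 2 * w m * (\<Sum>k<m. w k * B k m) + (w m)\<^sup>2 * B m m"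
    by (rule quad_Suc) (use assms in \<open>auto simp: psd_def\<close>)
  also have "\<dots> = B i i + 2 * t * B i m"
    unfolding a b using im assms(2) by (simp add: w_def)
  also have "\<dots> = -1" using nz by (simp add: t_def field_simps)
  finally show False using assms(1) by (metis psd_def neg_0_le_iff_le not_one_le_zero)
qed

text \<open>
  Induction on the size: \<open>A\<close> splits into a rank one matrix, whose Hadamard product with \<open>B\<close> is a
  diagonal congruence of \<open>B\<close>, and its Schur complement bordered by zeros.
\<close>
lemma schur_product:
  assumes "psd m A" "psd m B"
  shows "psd m (\<lambda>i j. A i j * B i j)"
  using assms
proof (induction m arbitrary: A)
  case 0
  then show ?case by (simp add: psd_def quad_def)
next
  case (Suc m)
  define a where "a = A m m"
  define C where "C i j = A i j - A i m * A j m / a" for i j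
  have sym: "\<And>i j. i \<le> m \<Longrightarrow> j \<le> m \<Longrightarrow> A i j = A j i"
    using Suc.prems by (auto simp: psd_def less_Suc_eq_le)
  have Cm: "C i m = 0" "C m i = 0" if "i \<le> m" for i
    using psd_zero_diag[OF Suc.prems(1) _ that] sym[OF that, of m]
    by (cases "A m m = 0"; simp add: C_def a_def)+
  have "psd m C"
    unfolding C_def a_def by (rule schur_complement_psd) (rule Suc.prems)
  then have CB: "psd m (\<lambda>i j. C i j * B i j)"
    using Suc.IH psd_mono[OF Suc.prems(2)] by simp
  have a0: "a \<ge> 0" unfolding a_def by (rule psd_diag[OF Suc.prems(1)]) simp
  have "0 \<le> quad (Suc m) (\<lambda>i j. A i j * B i j) v" for v
  proof -
    have "quad (Suc m) (\<lambda>i j. A i j * B i j) v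
      = quad (Suc m) (\<lambda>i j. C i j * B i j + (1 / a) * (A i m * A j m * B i j)) v"
      by (simp add: C_def algebra_simps)
    also have "\<dots> = quad (Suc m) (\<lambda>i j. C i j * B i j) v + (1 / a) * quad (Suc m) (\<lambda>i j. A i m * A j m * B i j) v"
      unfolding quad_add quad_scale ..
    also have "quad (Suc m) (\<lambda>i j. C i j * B i j) v = quad m (\<lambda>i j. C i j * B i j) v"
      by (rule quad_zero_border) (auto simp: Cm)
    also have "quad (Suc m) (\<lambda>i j. A i m * A j m * B i j) v = quad (Suc m) B (\<lambda>i. v i * A i m)"
      by (simp add: quad_def mult_ac)
    finally show ?thesis using CB Suc.prems(2) a0 by (simp add: psd_def)
  qed
  then show ?case using Suc.prems by (simp add: psd_def)
qed

lemma psd_power: assumes "psd m B" shows "psd m (\<lambda>i j. B i j ^ k)"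
proof (induction k)
  case 0
  show ?case using psd_rank_one[of m "\<lambda>_. 1"] by simp
next
  case (Suc k)
  then show ?case using schur_product[OF assms Suc.IH] by simp
qed

section \<open>Domination of a power on positive semidefinite matrices\<close>

text \<open>
  The coefficient of a power may always be increased, since entrywise powers keep positive
  semidefiniteness. In particular only the most negative admissible coefficient matters.
\<close>
lemma psd_larger_coeff:
  assumes "psd m (\<lambda>i j. F i j - d * B i j ^ M)" "psd m B" "- d \<le> e"
  shows "psd m (\<lambda>i j. F i j + e * B i j ^ M)"
proof -
  have "psd m (\<lambda>i j. (F i j - d * B i j ^ M) + (e + d) * B i j ^ M)"
    using assms by (intro psd_add psd_scale psd_power) auto
  then show ?thesis by (simp add: algebra_simps)
qed

text \<open>
  The argument of FitzGerald and Horn. Write \<open>B = P + C\<close>, where \<open>P\<close> has rank one and \<open>C\<close> is positive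
  semidefinite with vanishing last row and column. Along the segment \<open>P + t C\<close> the quadratic form of
  \<open>F\<close> has as derivative the quadratic form of the Hadamard product of \<open>C\<close> with the derivative \<open>F'\<close>.
  Since \<open>C\<close> lives on a block of size one less, and \<open>F'\<close> is again a sum of powers (one fewer at most)
  minus a small multiple of a higher power, this is nonnegative by induction and the Schur product
  theorem. At \<open>t = 0\<close> the form is nonnegative by the rank one case.
\<close>
lemma power_domination:
  fixes \<rho> :: real and c :: "nat \<Rightarrow> real"
  assumes "\<rho> > 0" "finite E" "m \<le> card E" "\<And>k. k \<in> E \<Longrightarrow> k < M" "\<And>k. k \<in> E \<Longrightarrow> c k > 0"
  shows "\<exists>\<delta>>0. \<forall>B. psd m B \<longrightarrow> (\<forall>i<m. \<forall>j<m. B i j \<in> {0<..<\<rho>}) \<longrightarrow>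
           psd m (\<lambda>i j. (\<Sum>k\<in>E. c k * B i j ^ k) - \<delta> * B i j ^ M)"
  using assms(2-)
proof (induction m arbitrary: E M c)
  case 0
  show ?case by (intro exI[of _ 1]) (simp add: psd_def quad_def)
next
  case (Suc m)
  define E0 where "E0 = E - {0}"
  define E' where "E' = (\<lambda>k. k - 1) ` E0"
  define c' where "c' k = c (k + 1) * real (k + 1)" for k
  have inj: "inj_on (\<lambda>k. k - 1) E0"
    by (rule inj_onI) (auto simp: E0_def)
  have finE: "finite E0" "finite E'" using Suc.prems by (auto simp: E0_def E'_def)
  (* The power 0 is lost under differentiation, so up to one exponent disappears. *)
  have "card E - 1 \<le> card E0" unfolding E0_def by (simp add: card_Diff_singleton_if)
  then have cE': "m \<le> card E'" using Suc.prems(2) inj by (simp add: E'_def card_image)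
  have E'M: "k < M - 1" if kE': "k \<in> E'" for k
  proof -
    obtain l where "l \<in> E" "l \<noteq> 0" "k = l - 1" using kE' by (auto simp: E'_def E0_def)
    then show ?thesis using Suc.prems(3)[of l] by auto
  qed
  have c'pos: "c' k > 0" if kE': "k \<in> E'" for k
  proof -
    obtain l where "l \<in> E" "l \<noteq> 0" "k = l - 1" using kE' by (auto simp: E'_def E0_def)
    then have "k + 1 \<in> E" by simp
    then show ?thesis using Suc.prems(4) by (simp add: c'_def)
  qed
  obtain \<delta>1 where \<delta>1: "\<delta>1 > 0" "\<forall>B. psd m B \<longrightarrow> (\<forall>i<m. \<forall>j<m. B i j \<in> {0<..<\<rho>}) \<longrightarrow>
           psd m (\<lambda>i j. (\<Sum>k\<in>E'. c' k * B i j ^ k) - \<delta>1 * B i j ^ (M - 1))"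
    using Suc.IH[where c = c', OF finE(2) cE' E'M c'pos] by blast
  have "sqrt \<rho> > 0" using assms(1) by simp
  from rank_one_domination[where c = c, OF this Suc.prems]
  obtain \<delta>0 where \<delta>0: "\<delta>0 > 0" "\<forall>u v. (\<forall>i<Suc m. u i \<in> {0<..sqrt \<rho>}) \<longrightarrow>
           \<delta>0 * (\<Sum>i<Suc m. v i * u i ^ M)\<^sup>2 \<le> (\<Sum>k\<in>E. c k * (\<Sum>i<Suc m. v i * u i ^ k)\<^sup>2)"
    by auto
  have "card E > 0" using Suc.prems(2) by simp
  then obtain e where "e \<in> E" by (metis card.empty equals0I less_irrefl)
  then have M: "M > 0" using Suc.prems(3) by fastforce
  define \<delta> where "\<delta> = min \<delta>0 (\<delta>1 / real M)"
  have \<delta>: "\<delta> > 0" "\<delta> \<le> \<delta>0" "\<delta> * real M \<le> \<delta>1"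
    using \<delta>0(1) \<delta>1(1) M by (auto simp: \<delta>_def min_def field_simps)
  define F where "F x = (\<Sum>k\<in>E. c k * x ^ k) - \<delta> * x ^ M" for x :: real
  define F' where "F' x = (\<Sum>k\<in>E'. c' k * x ^ k) - \<delta> * real M * x ^ (M - 1)" for x :: real
  have F: "(F has_real_derivative F' x) (at x)" for x
  proof -
    have "(\<Sum>k\<in>E. c k * (real k * x ^ (k - 1))) = (\<Sum>k\<in>E0. c k * (real k * x ^ (k - 1)))"
      unfolding E0_def by (rule sum.mono_neutral_right) (use Suc.prems in auto)
    also have "\<dots> = (\<Sum>k\<in>E'. c' k * x ^ k)"
      unfolding E'_def sum.reindex[OF inj] by (intro sum.cong) (auto simp: E0_def c'_def)
    finally have "F' x = (\<Sum>k\<in>E. c k * (real k * x ^ (k - 1))) - \<delta> * (real M * x ^ (M - 1))"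
      by (simp add: F'_def)
    moreover have "(F has_real_derivative (\<Sum>k\<in>E. c k * (real k * x ^ (k - 1))) - \<delta> * (real M * x ^ (M - 1))) (at x)"
      unfolding F_def[abs_def] by (auto intro!: derivative_eq_intros simp: mult_ac)
    ultimately show ?thesis by simp
  qed
  have "psd (Suc m) (\<lambda>i j. F (B i j))"
    if B: "psd (Suc m) B" and ent: "\<forall>i<Suc m. \<forall>j<Suc m. B i j \<in> {0<..<\<rho>}" for B
  proof -
    define a where "a = B m m"
    have a: "a > 0" using ent by (simp add: a_def)
    define u where "u i = B i m / sqrt a" for i
    define C where "C i j = B i j - B i m * B j m / a" for i j
    have uu: "u i * u j = B i m * B j m / a" for i j using a by (simp add: u_def)
    have u: "0 < u i" "u i < sqrt \<rho>" if "i < Suc m" for i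
    proof -
      show "0 < u i" using ent that a by (simp add: u_def)
      have "(u i)\<^sup>2 = (B i m)\<^sup>2 / a" by (simp add: power2_eq_square uu)
      also have "\<dots> \<le> B i i"
        using psd_entry_square[OF B, of i] that a by (cases "i = m") (auto simp: a_def power2_eq_square)
      also have "\<dots> < \<rho>" using ent that by simp
      finally show "u i < sqrt \<rho>" using real_less_rsqrt by blast
    qed
    have symB: "\<And>i j. i \<le> m \<Longrightarrow> j \<le> m \<Longrightarrow> B i j = B j i"
      using B by (auto simp: psd_def less_Suc_eq_le)
    have Cm: "C i m = 0" "C m i = 0" if "i \<le> m" for i
      using a symB[OF that, of m] by (auto simp: C_def a_def)
    have Cpsd: "psd m C"
      unfolding C_def a_def by (rule schur_complement_psd) (rule B)
    have "0 \<le> quad (Suc m) (\<lambda>i j. F (B i j)) v" for v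
    proof -
      define \<phi> where "\<phi> t = quad (Suc m) (\<lambda>i j. F (u i * u j + t * C i j)) v" for t
      have "\<phi> 0 \<le> \<phi> 1"
      proof (rule DERIV_nonneg_imp_nondecreasing[where f = \<phi> and a = 0 and b = 1])
        fix t :: real assume t: "0 \<le> t" "t \<le> 1"
        define A where "A i j = u i * u j + t * C i j" for i j
        have "(\<phi> has_real_derivative quad (Suc m) (\<lambda>i j. C i j * F' (A i j)) v) (at t)"
          unfolding \<phi>_def[abs_def] quad_def A_def
          by (auto intro!: derivative_eq_intros DERIV_chain2[OF F] sum.cong simp: mult_ac)
        moreover have "0 \<le> quad (Suc m) (\<lambda>i j. C i j * F' (A i j)) v"
        proof -
          have A: "A i j = (1 - t) * (u i * u j) + t * B i j" for i j
            unfolding A_def C_def uu[symmetric] by (simp add: algebra_simps)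
          have "psd m A"
            unfolding A[abs_def] using t psd_mono[OF B, of m]
            by (intro psd_add psd_scale psd_rank_one) auto
          moreover have "A i j \<in> {0<..<\<rho>}" if "i < m" "j < m" for i j
          proof -
            have "u i * u j < sqrt \<rho> * sqrt \<rho>"
              using u[of i] u[of j] that assms(1) by (intro mult_strict_mono) auto
            then have p: "u i * u j \<in> {0<..<\<rho>}" using u[of i] u[of j] that assms(1) by simp
            have q: "B i j \<in> {0<..<\<rho>}" using ent that by simp
            show ?thesis
            proof (cases "t = 1")
              case True then show ?thesis using q unfolding A by simp
            next
              case False
              then have t1: "1 - t > 0" using t by simp
              have "0 < (1 - t) * (u i * u j)" "0 \<le> t * B i j" using p q t t1 by auto
              moreover have "(1 - t) * (u i * u j) < (1 - t) * \<rho>" "t * B i j \<le> t * \<rho>"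
                using p q t t1 by (auto intro: mult_left_mono)
              moreover have "(1 - t) * \<rho> + t * \<rho> = \<rho>" by (simp add: algebra_simps)
              ultimately show ?thesis unfolding A by simp
            qed
          qed
          ultimately have "psd m (\<lambda>i j. (\<Sum>k\<in>E'. c' k * A i j ^ k) - \<delta>1 * A i j ^ (M - 1))" "psd m A"
            using \<delta>1(2) by auto
          then have "psd m (\<lambda>i j. F' (A i j))"
            using psd_larger_coeff[of m "\<lambda>i j. \<Sum>k\<in>E'. c' k * A i j ^ k" \<delta>1 A "M - 1" "- (\<delta> * real M)"] \<delta>(3)
            by (simp add: F'_def)
          then have "psd m (\<lambda>i j. C i j * F' (A i j))" by (rule schur_product[OF Cpsd])
          moreover have "quad (Suc m) (\<lambda>i j. C i j * F' (A i j)) v = quad m (\<lambda>i j. C i j * F' (A i j)) v"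
            by (rule quad_zero_border) (auto simp: Cm)
          ultimately show ?thesis by (simp add: psd_def)
        qed
        ultimately show "\<exists>y. (\<phi> has_real_derivative y) (at t) \<and> 0 \<le> y" by blast
      qed simp
      moreover have "\<phi> 1 = quad (Suc m) (\<lambda>i j. F (B i j)) v"
        by (simp add: \<phi>_def C_def uu)
      moreover have "0 \<le> \<phi> 0"
      proof -
        have sq: "quad (Suc m) (\<lambda>i j. (u i * u j) ^ k) v = (\<Sum>i<Suc m. v i * u i ^ k)\<^sup>2" for k
          using quad_rank_one[of "Suc m" "\<lambda>i. u i ^ k" v] by (simp add: power_mult_distrib)
        have "\<phi> 0 = quad (Suc m) (\<lambda>i j. (\<Sum>k\<in>E. c k * (u i * u j) ^ k) + (- \<delta>) * (u i * u j) ^ M) v"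
          by (simp add: \<phi>_def F_def)
        also have "\<dots> = (\<Sum>k\<in>E. c k * (\<Sum>i<Suc m. v i * u i ^ k)\<^sup>2) - \<delta> * (\<Sum>i<Suc m. v i * u i ^ M)\<^sup>2"
          unfolding quad_add quad_scale quad_sum sq by simp
        also have "\<dots> \<ge> (\<Sum>k\<in>E. c k * (\<Sum>i<Suc m. v i * u i ^ k)\<^sup>2) - \<delta>0 * (\<Sum>i<Suc m. v i * u i ^ M)\<^sup>2"
          by (intro diff_left_mono mult_right_mono \<delta>) simp
        moreover have "\<delta>0 * (\<Sum>i<Suc m. v i * u i ^ M)\<^sup>2 \<le> (\<Sum>k\<in>E. c k * (\<Sum>i<Suc m. v i * u i ^ k)\<^sup>2)"
          using \<delta>0(2) u by (auto simp: less_imp_le)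
        ultimately show ?thesis by linarith
      qed
      ultimately show ?thesis by simp
    qed
    then show ?thesis using symB by (simp add: psd_def)
  qed
  then show ?case using \<delta>(1) unfolding F_def by blast
qed

section \<open>Minors and positive semidefiniteness\<close>

text \<open>
  Rows and columns are selected by index functions rather than sets, so that deleting, inserting and
  shifting indices are compositions of functions.
\<close>
definition minor :: "nat \<Rightarrow> (nat \<Rightarrow> nat \<Rightarrow> real) \<Rightarrow> (nat \<Rightarrow> nat) \<Rightarrow> (nat \<Rightarrow> nat) \<Rightarrow> real" where
  "minor k A r c = det (mat k k (\<lambda>(i, j). A (r i) (c j)))"

definition index_seq :: "nat \<Rightarrow> nat \<Rightarrow> (nat \<Rightarrow> nat) \<Rightarrow> bool" where
  "index_seq k m r \<longleftrightarrow> (\<forall>i j. i < j \<longrightarrow> j < k \<longrightarrow> r i < r j) \<and> (\<forall>i<k. r i < m)"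

lemma minor_cong:
  assumes "\<And>i j. i < k \<Longrightarrow> j < k \<Longrightarrow> A (r i) (c j) = A' (r' i) (c' j)"
  shows "minor k A r c = minor k A' r' c'"
  unfolding minor_def by (intro arg_cong[of _ _ det] eq_matI) (use assms in auto)

lemma minor_0 [simp]: "minor 0 A r c = 1"
  by (simp add: minor_def)

lemma minor_1: "minor (Suc 0) A r c = A (r 0) (c 0)"
  unfolding minor_def by (subst det_single) auto

lemma minor_2: "minor 2 A r c = A (r 0) (c 0) * A (r 1) (c 1) - A (r 0) (c 1) * A (r 1) (c 0)"
proof -
  let ?X = "mat 2 2 (\<lambda>(i, j). A (r i) (c j))"
  have "det ?X = (\<Sum>j<2. ?X $$ (1, j) * cofactor ?X 1 j)"
    by (rule laplace_expansion_row) auto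
  also have "\<dots> = A (r 1) (c 0) * cofactor ?X 1 0 + A (r 1) (c 1) * cofactor ?X 1 1"
    by (simp add: numeral_2_eq_2)
  also have "cofactor ?X 1 0 = - A (r 0) (c 1)"
    unfolding cofactor_def by (subst det_single) (auto simp: mat_delete_def)
  also have "cofactor ?X 1 1 = A (r 0) (c 0)"
    unfolding cofactor_def by (subst det_single) (auto simp: mat_delete_def)
  finally show ?thesis by (simp add: minor_def algebra_simps)
qed

lemma minor_transpose: "minor k A r c = minor k (\<lambda>i j. A j i) c r"
proof -
  have "mat k k (\<lambda>(i, j). A (r j) (c i)) = transpose_mat (mat k k (\<lambda>(i, j). A (r i) (c j)))"
    by (rule eq_matI) auto
  then show ?thesis unfolding minor_def by (simp add: det_transpose[of _ k])
qed

lemma minor_leibniz: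
  "minor k A r c = (\<Sum>p | p permutes {0..<k}. signof p * (\<Prod>i=0..<k. A (r i) (c (p i))))"
proof -
  have "minor k A r c = (\<Sum>p | p permutes {0..<k}. signof p *
      (\<Prod>i=0..<k. mat k k (\<lambda>(i, j). A (r i) (c j)) $$ (i, p i)))"
    unfolding minor_def by (rule det_def') simp
  also have "\<dots> = (\<Sum>p | p permutes {0..<k}. signof p * (\<Prod>i=0..<k. A (r i) (c (p i))))"
    by (intro sum.cong refl arg_cong2[of _ _ _ _ "(*)"] prod.cong)
      (use permutes_in_image in fastforce)+
  finally show ?thesis .
qed

text \<open>
  Column operations that use the entry \<open>A m m\<close> clear the rest of the last row; they form the unit lower
  triangular matrix \<open>U\<close>.
\<close>
lemma minor_schur_complement:
  assumes "A m m \<noteq> 0"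
  shows "minor (Suc k) A (r(k := m)) (c(k := m))
           = A m m * minor k (\<lambda>i j. A i j - A i m * A m j / A m m) r c"
proof -
  let ?r = "r(k := m)" and ?c = "c(k := m)"
  define X where "X = mat (Suc k) (Suc k) (\<lambda>(i, j). A (?r i) (?c j))"
  define U where "U = mat (Suc k) (Suc k) (\<lambda>(i, j). if i = j then 1 else if i = k then - A m (?c j) / A m m else 0)"
  define Y where "Y = mat (Suc k) (Suc k)
    (\<lambda>(i, j). if j = k then A (?r i) m else A (?r i) (?c j) - A (?r i) m * A m (?c j) / A m m)"
  have X: "X \<in> carrier_mat (Suc k) (Suc k)" and U: "U \<in> carrier_mat (Suc k) (Suc k)"
    and Y: "Y \<in> carrier_mat (Suc k) (Suc k)" by (auto simp: X_def U_def Y_def)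
  have "X * U = Y"
  proof (rule eq_matI)
    fix i j assume "i < dim_row Y" "j < dim_col Y"
    then have ij: "i < Suc k" "j < Suc k" by (auto simp: Y_def)
    have "(X * U) $$ (i, j) = (\<Sum>l<Suc k. X $$ (i, l) * U $$ (l, j))"
      using ij X U by (simp add: scalar_prod_def atLeast0LessThan)
    also have "\<dots> = (\<Sum>l<k. X $$ (i, l) * U $$ (l, j)) + X $$ (i, k) * U $$ (k, j)"
      by simp
    also have "(\<Sum>l<k. X $$ (i, l) * U $$ (l, j)) = (\<Sum>l<k. if l = j then X $$ (i, l) else 0)"
      by (rule sum.cong) (use ij in \<open>auto simp: U_def\<close>)
    also have "(\<Sum>l<k. if l = j then X $$ (i, l) else 0) + X $$ (i, k) * U $$ (k, j) = Y $$ (i, j)"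
      using ij by (cases "j = k") (auto simp: X_def U_def Y_def)
    finally show "(X * U) $$ (i, j) = Y $$ (i, j)" .
  qed (auto simp: X_def U_def Y_def)
  moreover have "det U = 1"
  proof -
    have "det U = prod_list (diag_mat U)"
      by (rule det_lower_triangular[OF _ U]) (auto simp: U_def)
    also have "diag_mat U = replicate (Suc k) 1"
      by (rule nth_equalityI) (auto simp: diag_mat_def U_def simp del: upt_Suc replicate_Suc)
    finally show ?thesis by simp
  qed
  ultimately have "det X = det Y" using det_mult[OF X U] by simp
  also have "det Y = (\<Sum>j<Suc k. Y $$ (k, j) * cofactor Y k j)"
    by (rule laplace_expansion_row[OF Y]) simp
  also have "\<dots> = Y $$ (k, k) * cofactor Y k k"
    using assms by (simp add: Y_def)
  also have "Y $$ (k, k) = A m m" by (simp add: Y_def)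
  also have "cofactor Y k k = minor k (\<lambda>i j. A i j - A i m * A m j / A m m) r c"
  proof -
    have "mat_delete Y k k = mat k k (\<lambda>(i, j). A (r i) (c j) - A (r i) m * A m (c j) / A m m)"
      by (rule eq_matI) (auto simp: mat_delete_def Y_def)
    then show ?thesis by (simp add: cofactor_def minor_def)
  qed
  finally show ?thesis by (simp add: minor_def X_def)
qed

text \<open>
  If the last diagonal entry \<open>A m m\<close> is positive, the principal minors of the Schur complement are, up
  to that factor, principal minors of \<open>A\<close>, so the Schur complement is positive semidefinite by
  induction and completing the square transfers this to \<open>A\<close>. If it is zero, the principal minors of size 2
  make the last row vanish.
\<close>
lemma psd_of_principal_minors:
  assumes "\<And>i j. i < m \<Longrightarrow> j < m \<Longrightarrow> A i j = A j i"
    and "\<And>k r. index_seq k m r \<Longrightarrow> 0 \<le> minor k A r r"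
  shows "psd m A"
  using assms
proof (induction m arbitrary: A)
  case 0
  then show ?case by (simp add: psd_def quad_def)
next
  case (Suc m)
  define C where "C = (\<lambda>i j. A i j - A i m * A j m / A m m)"
  have "0 \<le> minor 1 A (\<lambda>_. m) (\<lambda>_. m)"
    by (rule Suc.prems(2)) (auto simp: index_seq_def)
  then have a: "A m m \<ge> 0" by (simp add: minor_1)
  show ?case
  proof (cases "A m m = 0")
    case True
    have zero: "A i m = 0" if "i < m" for i
    proof -
      have "0 \<le> minor 2 A (\<lambda>l. if l = 0 then i else m) (\<lambda>l. if l = 0 then i else m)"
        by (rule Suc.prems(2)) (use that in \<open>auto simp: index_seq_def less_Suc_eq numeral_2_eq_2\<close>)
      also have "\<dots> = - (A i m)\<^sup>2"
        using True Suc.prems(1)[of i m] that by (simp add: minor_2 power2_eq_square)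
      finally show ?thesis by simp
    qed
    have "psd m A"
      using Suc.prems by (intro Suc.IH) (auto simp: index_seq_def less_Suc_eq)
    moreover have "quad (Suc m) A v = quad m A v" for v
    proof (rule quad_zero_border)
      show "A i m = 0" if "i \<le> m" for i using zero[of i] True that by (cases "i = m") auto
      then show "A m i = 0" if "i \<le> m" for i using Suc.prems(1)[of m i] that by simp
    qed
    ultimately show ?thesis using Suc.prems(1) by (simp add: psd_def)
  next
    case False
    have "psd m C"
    proof (rule Suc.IH)
      show "C i j = C j i" if "i < m" "j < m" for i j
        using Suc.prems(1)[of i j] that by (simp add: C_def)
      show "0 \<le> minor k C r r" if r: "index_seq k m r" for k r
      proof -
        have "0 \<le> minor (Suc k) A (r(k := m)) (r(k := m))"
          by (rule Suc.prems(2)) (use r in \<open>auto simp: index_seq_def less_Suc_eq\<close>)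
        also have "\<dots> = A m m * minor k (\<lambda>i j. A i j - A i m * A m j / A m m) r r"
          by (rule minor_schur_complement[where A = A and m = m, OF False])
        also have "minor k (\<lambda>i j. A i j - A i m * A m j / A m m) r r = minor k C r r"
        proof (rule minor_cong)
          fix i j assume "i < k" "j < k"
          then have "r i < m" "r j < m" using r by (auto simp: index_seq_def)
          then show "A (r i) (r j) - A (r i) m * A m (r j) / A m m = C (r i) (r j)"
            using Suc.prems(1)[of m "r j"] by (simp add: C_def)
        qed
        finally show ?thesis using a False by (simp add: zero_le_mult_iff)
      qed
    qed
    moreover have "quad (Suc m) A v = quad m C v + A m m * (v m + (\<Sum>i<m. v i * A i m) / A m m)\<^sup>2" for v
      unfolding C_def
    proof (rule quad_complete_square)
      show "A m i = A i m" if "i < m" for i using Suc.prems(1)[of m i] that by simp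
    qed (rule False)
    ultimately show ?thesis using Suc.prems(1) a by (simp add: psd_def)
  qed
qed

definition pd :: "nat \<Rightarrow> (nat \<Rightarrow> nat \<Rightarrow> real) \<Rightarrow> bool" where
  "pd m B \<longleftrightarrow> (\<forall>i<m. \<forall>j<m. B i j = B j i) \<and> (\<forall>v. (\<exists>i<m. v i \<noteq> 0) \<longrightarrow> 0 < quad m B v)"

lemma pdD: "pd m B \<Longrightarrow> i < m \<Longrightarrow> v i \<noteq> 0 \<Longrightarrow> 0 < quad m B v"
  by (auto simp: pd_def)

text \<open>
  The determinant is the product of the pivots, which are diagonal entries of successive Schur complements.
\<close>
lemma pd_minor_pos: "pd m A \<Longrightarrow> 0 < minor m A id id"
proof (induction m arbitrary: A)
  case 0
  show ?case by simp
next
  case (Suc m)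
  define C where "C = (\<lambda>i j. A i j - A i m * A j m / A m m)"
  have sym: "\<And>i j. i \<le> m \<Longrightarrow> j \<le> m \<Longrightarrow> A i j = A j i"
    using Suc.prems by (auto simp: pd_def less_Suc_eq_le)
  have "0 < quad (Suc m) A (\<lambda>i. if i = m then 1 else 0)"
    by (rule pdD[OF Suc.prems, of m]) auto
  also have "\<dots> = A m m"
    using sym by (subst quad_Suc) (auto simp: quad_def)
  finally have a: "A m m > 0" .
  have "pd m C"
    unfolding pd_def
  proof (intro conjI allI impI)
    show "C i j = C j i" if "i < m" "j < m" for i j using sym that by (simp add: C_def)
    show "0 < quad m C v" if v: "\<exists>i<m. v i \<noteq> 0" for v
    proof -
      have "quad m C v = quad (Suc m) A (v(m := - (\<Sum>i<m. v i * A i m) / A m m))"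
        unfolding C_def by (rule quad_schur_complement) (use sym a in auto)
      moreover obtain i where "i < m" "v i \<noteq> 0" using v by blast
      ultimately show ?thesis using pdD[OF Suc.prems, of i] by simp
    qed
  qed
  then have "0 < minor m C id id" by (rule Suc.IH)
  also have "minor m C id id = minor m (\<lambda>i j. A i j - A i m * A m j / A m m) id id"
    by (rule minor_cong) (use sym in \<open>auto simp: C_def\<close>)
  finally have "0 < A m m * minor m (\<lambda>i j. A i j - A i m * A m j / A m m) id id"
    using a by simp
  also have "\<dots> = minor (Suc m) A (id(m := m)) (id(m := m))"
    by (rule minor_schur_complement[symmetric]) (use a in simp)
  also have "id(m := m) = id" by auto
  finally show ?case .
qed

section \<open>Fekete's criterion\<close>

text \<open>
  Laplace expansion, along the last column, of the determinant whose last column repeats column \<open>j\<close>.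
\<close>
lemma minor_null_vector:
  assumes "j < p"
  shows "(\<Sum>i<Suc p. (-1) ^ i * minor p A (r \<circ> insert_index i) c * A (r i) (c j)) = 0"
proof -
  define X where "X = mat (Suc p) (Suc p) (\<lambda>(i, l). A (r i) (c (if l = p then j else l)))"
  have X: "X \<in> carrier_mat (Suc p) (Suc p)" by (simp add: X_def)
  have cof: "cofactor X i p = (-1) ^ p * ((-1) ^ i * minor p A (r \<circ> insert_index i) c)" if "i < Suc p" for i
  proof -
    have "mat_delete X i p = mat p p (\<lambda>(a, b). A ((r \<circ> insert_index i) a) (c b))"
      by (rule eq_matI) (auto simp: mat_delete_def X_def insert_index_def)
    then show ?thesis by (simp add: cofactor_def minor_def power_add)
  qed
  have Xp: "X $$ (i, p) = A (r i) (c j)" if "i < Suc p" for i using that by (simp add: X_def)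
  have "0 = det X"
    by (rule det_identical_columns[OF X, of j p, symmetric]) (use assms in \<open>auto simp: X_def\<close>)
  also have "\<dots> = (\<Sum>i<Suc p. X $$ (i, p) * cofactor X i p)"
    by (rule laplace_expansion_column[OF X]) simp
  also have "\<dots> = (\<Sum>i<Suc p. (-1) ^ p * ((-1) ^ i * minor p A (r \<circ> insert_index i) c * A (r i) (c j)))"
    by (intro sum.cong) (auto simp: cof Xp mult_ac simp del: sum.lessThan_Suc)
  also have "\<dots> = (-1) ^ p * (\<Sum>i<Suc p. (-1) ^ i * minor p A (r \<circ> insert_index i) c * A (r i) (c j))"
    by (simp only: sum_distrib_left)
  finally show ?thesis by simp
qed

lemma minor_trivial_kernel:
  assumes "minor k A r c \<noteq> 0" "\<And>j. j < k \<Longrightarrow> (\<Sum>i<k. w i * A (r i) (c j)) = 0" "i < k"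
  shows "w i = 0"
proof (rule ccontr)
  assume "w i \<noteq> 0"
  let ?X = "mat k k (\<lambda>(i, j). A (r j) (c i))"
  have "vec k w \<noteq> 0\<^sub>v k"
  proof
    assume "vec k w = 0\<^sub>v k"
    then have "vec k w $ i = 0\<^sub>v k $ i" by simp
    then show False using \<open>w i \<noteq> 0\<close> assms(3) by simp
  qed
  moreover have "?X *\<^sub>v vec k w = 0\<^sub>v k"
    by (rule eq_vecI) (use assms(2) in \<open>auto simp: scalar_prod_def atLeast0LessThan mult.commute\<close>)
  ultimately have "det ?X = 0" 
    by (subst det_0_iff_vec_prod_zero_field[of _ k]) (auto intro!: exI[of _ "vec k w"])
  then show False using assms(1) by (subst (asm) minor_transpose) (simp add: minor_def)
qed

text \<open>
  A three-term Pluecker relation for the rows \<open>r 0, \<dots>, r (q + 1)\<close>, proved without sorting signs. The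
  vector \<open>y\<close> of maximal minors is orthogonal to \<open>q + 1\<close> columns; \<open>z\<close> and \<open>z'\<close> are orthogonal to the
  first \<open>q\<close> columns and are supported on all rows but the last and all rows but the first. A suitable
  combination vanishes at the first and last row, hence vanishes altogether as the minor on the
  remaining rows is nonzero; the identity is its entry at \<open>s\<close>.
\<close>
lemma minor_exchange:
  assumes D: "minor q A (r \<circ> Suc) c \<noteq> 0" and s: "1 \<le> s" "s \<le> q"
  shows "minor q A (r \<circ> Suc) c * minor (Suc q) A (r \<circ> insert_index s) c
       = minor (Suc q) A (r \<circ> Suc) c * minor q A (r \<circ> insert_index s) c
       + minor (Suc q) A r c * minor q A (r \<circ> Suc \<circ> insert_index (s - 1)) c"
proof -
  define y where "y i = (-1) ^ i * minor (Suc q) A (r \<circ> insert_index i) c" for i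
  define z where "z i = (-1) ^ i * minor q A (r \<circ> insert_index i) c" for i
  define z' where "z' i = (-1) ^ i * minor q A ((r \<circ> Suc) \<circ> insert_index i) c" for i
  define d where "d = minor q A (r \<circ> Suc) c"
  define M1 where "M1 = minor (Suc q) A (r \<circ> Suc) c"
  define M0 where "M0 = minor (Suc q) A r c"
  have y0: "y 0 = M1" by (auto simp: y_def M1_def intro!: minor_cong)
  have z0: "z 0 = d" by (auto simp: z_def d_def intro!: minor_cong)
  have yl: "y (Suc q) = (-1) ^ Suc q * M0" by (auto simp: y_def M0_def intro!: minor_cong)
  have z'l: "z' q = (-1) ^ q * d" by (auto simp: z'_def d_def intro!: minor_cong)
  define w where "w i = d * y (Suc i) - M1 * z (Suc i) + M0 * z' i" for i
  have "w i = 0" if "i < q" for i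
  proof (rule minor_trivial_kernel[OF D _ that])
    fix j assume j: "j < q"
    define a where "a i = A (r i) (c j)" for i
    have Y: "(\<Sum>i<q. y (Suc i) * a (Suc i)) = - y 0 * a 0 - y (Suc q) * a (Suc q)"
    proof -
      have "(\<Sum>i<Suc (Suc q). y i * a i) = 0"
        unfolding y_def a_def using j by (intro minor_null_vector) auto
      then show ?thesis
        by (subst (asm) sum.lessThan_Suc_shift) (simp add: algebra_simps eq_neg_iff_add_eq_0)
    qed
    have Z: "(\<Sum>i<q. z (Suc i) * a (Suc i)) = - z 0 * a 0"
    proof -
      have "(\<Sum>i<Suc q. z i * a i) = 0"
        unfolding z_def a_def using j by (intro minor_null_vector) auto
      then show ?thesis
        by (subst (asm) sum.lessThan_Suc_shift) (simp add: algebra_simps eq_neg_iff_add_eq_0)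
    qed
    have Z': "(\<Sum>i<q. z' i * a (Suc i)) = - z' q * a (Suc q)"
    proof -
      have "(\<Sum>i<Suc q. z' i * a (Suc i)) = 0"
        using minor_null_vector[OF j, of A "r \<circ> Suc" c] by (simp add: z'_def a_def)
      then show ?thesis by (simp add: algebra_simps eq_neg_iff_add_eq_0)
    qed
    have "(\<Sum>i<q. w i * a (Suc i)) = d * (\<Sum>i<q. y (Suc i) * a (Suc i))
        - M1 * (\<Sum>i<q. z (Suc i) * a (Suc i)) + M0 * (\<Sum>i<q. z' i * a (Suc i))"
      by (simp add: w_def sum.distrib sum_subtractf sum_distrib_left algebra_simps)
    also have "\<dots> = 0"
      unfolding Y Z Z' y0 z0 yl z'l by (simp add: algebra_simps)
    finally show "(\<Sum>i<q. w i * A ((r \<circ> Suc) i) (c j)) = 0" by (simp add: a_def)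
  qed
  then have "w (s - 1) = 0" using s by simp
  then have "d * y s = M1 * z s - M0 * z' (s - 1)" using s by (simp add: w_def)
  moreover have "(-1 :: real) ^ s = - ((-1) ^ (s - 1))" using s by (cases s) auto
  ultimately have "(-1) ^ (s - 1) * (d * minor (Suc q) A (r \<circ> insert_index s) c)
     = (-1) ^ (s - 1) * (M1 * minor q A (r \<circ> insert_index s) c + M0 * minor q A (r \<circ> Suc \<circ> insert_index (s - 1)) c)"
    by (simp add: y_def z_def z'_def algebra_simps)
  then show ?thesis by (simp add: d_def M1_def M0_def)
qed

lemma index_seqD: "index_seq k m r \<Longrightarrow> i < j \<Longrightarrow> j < k \<Longrightarrow> r i < r j" "index_seq k m r \<Longrightarrow> i < k \<Longrightarrow> r i < m"
  by (auto simp: index_seq_def)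

lemma index_seq_Suc: "index_seq (Suc k) m r \<Longrightarrow> index_seq k m (r \<circ> Suc)"
  by (auto simp: index_seq_def)

lemma index_seq_less: "index_seq (Suc k) m r \<Longrightarrow> index_seq k m r"
  by (auto simp: index_seq_def)

lemma index_seq_delete: "index_seq (Suc k) m r \<Longrightarrow> index_seq k m (r \<circ> insert_index i)"
  by (auto simp: index_seq_def insert_index_def)

lemma index_seq_interval: "a + k \<le> m \<Longrightarrow> index_seq k m (\<lambda>i. a + i)"
  by (auto simp: index_seq_def)

lemma index_seq_interval_or_gap:
  assumes r: "index_seq (Suc q) m r"
  shows "(\<forall>i\<le>q. r i = r 0 + i) \<or> (\<exists>s. 1 \<le> s \<and> s \<le> q \<and> r (s - 1) + 1 < r s)"
proof (rule disjCI)
  assume no: "\<not> (\<exists>s. 1 \<le> s \<and> s \<le> q \<and> r (s - 1) + 1 < r s)"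
  have "r i = r 0 + i" if "i \<le> q" for i
    using that
  proof (induction i)
    case (Suc i)
    have "r i < r (Suc i)" using Suc.prems index_seqD(1)[OF r, of i "Suc i"] by simp
    moreover have "\<not> r i + 1 < r (Suc i)" using no Suc.prems by force
    ultimately show ?case using Suc by simp
  qed simp
  then show "\<forall>i\<le>q. r i = r 0 + i" by blast
qed

text \<open>
  Induction on the spread \<open>r q - r 0\<close>. If the rows have a gap, inserting a row there and applying the
  exchange identity expresses the minor through positive minors of smaller spread or smaller size.
\<close>
lemma fekete_rows:
  assumes lower: "\<And>r. index_seq q m r \<Longrightarrow> 0 < minor q A r c"
    and contiguous: "\<And>a. a + Suc q \<le> m \<Longrightarrow> 0 < minor (Suc q) A (\<lambda>i. a + i) c"
    and "index_seq (Suc q) m r"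
  shows "0 < minor (Suc q) A r c"
  using assms(3)
proof (induction "r q - r 0" arbitrary: r rule: less_induct)
  case less
  note r = less.prems
  show ?case
  proof (cases "\<forall>i\<le>q. r i = r 0 + i")
    case True
    have "minor (Suc q) A r c = minor (Suc q) A (\<lambda>i. r 0 + i) c"
    proof (rule minor_cong)
      show "A (r i) (c j) = A (r 0 + i) (c j)" if "i < Suc q" for i j
        using True[rule_format, of i] that by simp
    qed
    moreover have "r 0 + Suc q \<le> m" using index_seqD(2)[OF r, of q] True[rule_format, of q] by simp
    ultimately show ?thesis using contiguous by simp
  next
    case False
    then obtain s where s: "1 \<le> s" "s \<le> q" "r (s - 1) + 1 < r s"
      using index_seq_interval_or_gap[OF r] by blast
    (* Insert the first missing index after r (s - 1); all minors in the exchange identity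
       other than the wanted one are then narrower or smaller. *)
    define r' where "r' i = (if i < s then r i else if i = s then r (s - 1) + 1 else r (i - 1))" for i
    have r': "index_seq (Suc (Suc q)) m r'"
      unfolding index_seq_def
    proof (intro conjI allI impI)
      have step: "r' i < r' (Suc i)" if "Suc i < Suc (Suc q)" for i
      proof -
        consider "Suc i < s" | "Suc i = s" | "i = s" | "i > s" by linarith
        then show ?thesis
        proof cases
          case 1 then show ?thesis using s index_seqD(1)[OF r, of i "Suc i"] by (simp add: r'_def)
        next
          case 2 then show ?thesis by (auto simp: r'_def)
        next
          case 3 then show ?thesis using s by (simp add: r'_def)
        next
          case 4 then show ?thesis using s that index_seqD(1)[OF r, of "i - 1" i] by (simp add: r'_def)
        qed
      qed
      show "r' i < r' j" if "i < j" "j < Suc (Suc q)" for i j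
        using that
      proof (induction j)
        case (Suc j)
        then show ?case using step[of j] by (cases "i = j") auto
      qed simp
      show "r' i < m" if "i < Suc (Suc q)" for i
        using that s index_seqD(2)[OF r, of "i - 1"] index_seqD(2)[OF r, of i] index_seqD(2)[OF r, of s]
        by (auto simp: r'_def)
    qed
    have r's: "minor (Suc q) A (r' \<circ> insert_index s) c = minor (Suc q) A r c"
      by (rule minor_cong) (auto simp: r'_def insert_index_def)
    have ends: "r' 0 = r 0" "r' (Suc q) = r q" using s by (auto simp: r'_def)
    have mono: "r' 0 < r' 1" "r' q < r' (Suc q)" "r' 1 \<le> r' (Suc q)" "r' 0 \<le> r' q"
      using index_seqD(1)[OF r', of 0 1] index_seqD(1)[OF r', of q "Suc q"]
        index_seqD(1)[OF r', of 1 "Suc q"] index_seqD(1)[OF r', of 0 q] s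
      by (auto simp: le_less)
    have "0 < minor (Suc q) A (r' \<circ> Suc) c"
      by (rule less.hyps) (use ends mono index_seq_Suc[OF r'] in auto)
    moreover have "0 < minor (Suc q) A r' c"
      by (rule less.hyps) (use ends mono index_seq_less[OF r'] in auto)
    moreover have "0 < minor q A (r' \<circ> insert_index s) c"
      by (rule lower[OF index_seq_delete[OF index_seq_less[OF r']]])
    moreover have "0 < minor q A (r' \<circ> Suc \<circ> insert_index (s - 1)) c"
      by (rule lower[OF index_seq_delete[OF index_seq_Suc[OF r']]])
    moreover have D: "0 < minor q A (r' \<circ> Suc) c"
      by (rule lower[OF index_seq_less[OF index_seq_Suc[OF r']]])
    ultimately have "0 < minor q A (r' \<circ> Suc) c * minor (Suc q) A (r' \<circ> insert_index s) c"
      using s by (subst minor_exchange) (auto intro: add_pos_pos)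
    then show ?thesis using D r's by (simp add: zero_less_mult_iff)
  qed
qed

text \<open>
  Fekete's criterion: gaps are first filled among the rows, with contiguous columns, and then among the
  columns. Symmetry lets the same lemma serve for both.
\<close>
lemma fekete_symmetric:
  assumes sym: "\<And>i j. A i j = A j i"
    and contiguous: "\<And>q a b. a + q \<le> m \<Longrightarrow> b + q \<le> m \<Longrightarrow> 0 < minor q A (\<lambda>i. a + i) (\<lambda>j. b + j)"
  shows "index_seq q m r \<Longrightarrow> index_seq q m c \<Longrightarrow> 0 < minor q A r c"
proof (induction q arbitrary: r c)
  case 0
  show ?case by simp
next
  case (Suc q)
  have swap: "minor k A r c = minor k A c r" for k r c
    by (subst minor_transpose) (rule minor_cong, rule sym)
  have half: "0 < minor (Suc q) A r (\<lambda>j. b + j)" if "b + Suc q \<le> m" "index_seq (Suc q) m r" for b r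
    by (rule fekete_rows[where m = m])
      (use that in \<open>auto intro!: Suc.IH index_seq_interval contiguous\<close>)
  show ?case
  proof (rule fekete_rows[where m = m])
    show "0 < minor q A r' c" if "index_seq q m r'" for r'
      using that Suc.prems index_seq_less by (intro Suc.IH) auto
    show "0 < minor (Suc q) A (\<lambda>i. a + i) c" if "a + Suc q \<le> m" for a
      using half[OF that Suc.prems(2)] by (subst swap)
  qed (rule Suc.prems)
qed

section \<open>Hankel matrices\<close>

lemma sum_window:
  fixes g :: "nat \<Rightarrow> real"
  assumes "e + q \<le> m"
  shows "(\<Sum>i<m. if e \<le> i \<and> i < e + q then g i else 0) = (\<Sum>i<q. g (e + i))"
proof -
  have "(\<Sum>i<m. if e \<le> i \<and> i < e + q then g i else 0) = (\<Sum>i\<in>{e..<e + q}. g i)"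
    by (rule sum.mono_neutral_cong_right) (use assms in auto)
  also have "\<dots> = (\<Sum>i<q. g (e + i))"
    by (rule sum.reindex_bij_witness[of _ "\<lambda>i. e + i" "\<lambda>i. i - e"]) auto
  finally show ?thesis .
qed

lemma pd_window:
  assumes "pd m A" "e + q \<le> m"
  shows "pd q (\<lambda>i j. A (e + i) (e + j))"
  unfolding pd_def
proof (intro conjI allI impI)
  show "A (e + i) (e + j) = A (e + j) (e + i)" if "i < q" "j < q" for i j
    using assms that by (auto simp: pd_def)
  fix v :: "nat \<Rightarrow> real" assume "\<exists>i<q. v i \<noteq> 0"
  then obtain i where i: "i < q" "v i \<noteq> 0" by blast
  define w where "w i = (if e \<le> i \<and> i < e + q then v (i - e) else 0)" for i
  have "0 < quad m A w" by (rule pdD[OF assms(1), of "e + i"]) (use i assms(2) in \<open>auto simp: w_def\<close>)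
  also have "quad m A w = (\<Sum>i<m. if e \<le> i \<and> i < e + q then
      (\<Sum>j<m. if e \<le> j \<and> j < e + q then v (i - e) * v (j - e) * A i j else 0) else 0)"
    unfolding quad_def w_def by (intro sum.cong) (auto intro!: sum.cong)
  also have "\<dots> = quad q (\<lambda>i j. A (e + i) (e + j)) v"
    unfolding sum_window[OF assms(2)] by (simp add: quad_def)
  finally show "0 < quad q (\<lambda>i j. A (e + i) (e + j)) v" .
qed

text \<open>
  In a Hankel matrix a contiguous minor depends only on the sum \<open>a + b\<close> of its first row and column. It
  is therefore a principal minor of the matrix if the sum is even, and of the matrix shifted by one if it
  is odd.
\<close>
lemma hankel_minors_pos:
  fixes h :: "nat \<Rightarrow> real"
  assumes pd0: "pd m (\<lambda>i j. h (i + j))" and pd1: "pd (m - 1) (\<lambda>i j. h (i + j + 1))"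
    and "index_seq q m r" "index_seq q m c"
  shows "0 < minor q (\<lambda>i j. h (i + j)) r c"
proof (rule fekete_symmetric[where m = m])
  show "h (i + j) = h (j + i)" for i j by (simp add: add.commute)
  fix q a b assume ab: "a + q \<le> m" "b + q \<le> m"
  show "0 < minor q (\<lambda>i j. h (i + j)) (\<lambda>i. a + i) (\<lambda>j. b + j)"
  proof (cases "q = 0")
    case q: False
    show ?thesis
    proof (cases "even (a + b)")
      case True
      then obtain e where e: "a + b = 2 * e" by (elim evenE)
      have "pd q (\<lambda>i j. h ((e + i) + (e + j)))"
        by (rule pd_window[OF pd0]) (use e ab in linarith)
      then have "0 < minor q (\<lambda>i j. h ((e + i) + (e + j))) id id" by (rule pd_minor_pos)
      also have "\<dots> = minor q (\<lambda>i j. h (i + j)) (\<lambda>i. a + i) (\<lambda>j. b + j)"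
        by (rule minor_cong) (use e in \<open>auto intro!: arg_cong[of _ _ h]\<close>)
      finally show ?thesis .
    next
      case False
      then obtain e where e: "a + b = 2 * e + 1" by (elim oddE)
      have "pd q (\<lambda>i j. h ((e + i) + (e + j) + 1))"
        by (rule pd_window[OF pd1]) (use e ab q in linarith)
      then have "0 < minor q (\<lambda>i j. h ((e + i) + (e + j) + 1)) id id" by (rule pd_minor_pos)
      also have "\<dots> = minor q (\<lambda>i j. h (i + j)) (\<lambda>i. a + i) (\<lambda>j. b + j)"
        by (rule minor_cong) (use e in \<open>auto intro!: arg_cong[of _ _ h]\<close>)
      finally show ?thesis .
    qed
  qed simp
qed (use assms in auto)

text \<open>
  The form is \<open>\<Sum>l. \<omega> l * (p (x l))\<^sup>2\<close> for the polynomial \<open>p\<close> with coefficients \<open>v\<close>, which cannot vanish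
  at \<open>k\<close> distinct positive points.
\<close>
lemma pd_moments:
  fixes x \<omega> :: "nat \<Rightarrow> real"
  assumes "k \<le> m" "\<And>l. l < m \<Longrightarrow> 0 < \<omega> l" "\<And>l. l < m \<Longrightarrow> 0 < x l" "inj_on x {..<m}"
  shows "pd k (\<lambda>i j. \<Sum>l<m. \<omega> l * x l ^ (i + j))"
  unfolding pd_def
proof (intro conjI allI impI)
  show "(\<Sum>l<m. \<omega> l * x l ^ (i + j)) = (\<Sum>l<m. \<omega> l * x l ^ (j + i))" for i j by (simp add: add.commute)
  fix v :: "nat \<Rightarrow> real" assume "\<exists>i<k. v i \<noteq> 0"
  then obtain i where i: "i < k" "v i \<noteq> 0" by blast
  define p where "p l = (\<Sum>i<k. v i * x l ^ i)" for l
  have "quad k (\<lambda>i j. \<Sum>l<m. \<omega> l * x l ^ (i + j)) v = (\<Sum>i<k. \<Sum>j<k. \<Sum>l<m. \<omega> l * ((v i * x l ^ i) * (v j * x l ^ j)))"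
    by (simp add: quad_def sum_distrib_left power_add mult_ac)
  also have "\<dots> = (\<Sum>i<k. \<Sum>l<m. \<Sum>j<k. \<omega> l * ((v i * x l ^ i) * (v j * x l ^ j)))"
    by (intro sum.cong refl sum.swap)
  also have "\<dots> = (\<Sum>l<m. \<Sum>i<k. \<Sum>j<k. \<omega> l * ((v i * x l ^ i) * (v j * x l ^ j)))"
    by (rule sum.swap)
  also have "\<dots> = (\<Sum>l<m. \<omega> l * (p l)\<^sup>2)"
  proof (rule sum.cong[OF refl])
    fix l
    have "(p l)\<^sup>2 = (\<Sum>i<k. \<Sum>j<k. (v i * x l ^ i) * (v j * x l ^ j))"
      by (simp only: p_def power2_eq_square sum_product)
    then show "(\<Sum>i<k. \<Sum>j<k. \<omega> l * ((v i * x l ^ i) * (v j * x l ^ j))) = \<omega> l * (p l)\<^sup>2"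
      by (simp only: sum_distrib_left)
  qed
  finally have q: "quad k (\<lambda>i j. \<Sum>l<m. \<omega> l * x l ^ (i + j)) v = (\<Sum>l<m. \<omega> l * (p l)\<^sup>2)" .
  have "\<exists>l<k. p l \<noteq> 0"
  proof (rule ccontr)
    assume "\<not> ?thesis"
    then have z: "\<And>l. l < k \<Longrightarrow> p l = 0" by blast
    have inj: "inj_on x {..<k}" using assms(1,4) by (auto intro: inj_on_subset)
    have "v i = 0"
    proof (rule fewnomial_zero[of "{..<k}" "x ` {..<k}"])
      show "card (x ` {..<k}) = card {..<k}" by (rule card_image[OF inj])
      show "x ` {..<k} \<subseteq> {0<..}" using assms(1,3) by auto
      show "(\<Sum>k\<in>{..<k}. v k * y ^ k) = 0" if "y \<in> x ` {..<k}" for y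
        using that z by (auto simp: p_def)
    qed (use i in auto)
    then show False using i by simp
  qed
  then obtain l where l: "l < k" "p l \<noteq> 0" by blast
  show "0 < quad k (\<lambda>i j. \<Sum>l<m. \<omega> l * x l ^ (i + j)) v"
    unfolding q
    by (rule sum_pos2[of _ l]) (use l assms(1,2) in \<open>auto simp: less_imp_le\<close>)
qed

lemma psd_plus_pd:
  assumes "psd m A" "pd m B" "0 < t"
  shows "pd m (\<lambda>i j. A i j + t * B i j)"
  using assms by (auto simp: psd_def pd_def quad_add quad_scale intro!: add_nonneg_pos)

text \<open>
  Perturbation by a small multiple of the moment sequence \<open>g\<close>, for which both Hankel forms are positive
  definite, reduces this to the strict case.
\<close>
lemma hankel_minors_nonneg:
  fixes h :: "nat \<Rightarrow> real"
  assumes psd0: "psd m (\<lambda>i j. h (i + j))" and psd1: "psd (m - 1) (\<lambda>i j. h (i + j + 1))"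
    and rc: "index_seq q m r" "index_seq q m c"
  shows "0 \<le> minor q (\<lambda>i j. h (i + j)) r c"
proof -
  define x where "x l = real l + 1" for l
  define g where "g n = (\<Sum>l<m. x l ^ n)" for n
  have g0: "pd m (\<lambda>i j. g (i + j))"
    using pd_moments[of m m "\<lambda>_. 1" x] by (simp add: g_def x_def inj_on_def)
  have g1: "pd (m - 1) (\<lambda>i j. g (i + j + 1))"
    using pd_moments[of "m - 1" m x x] by (simp add: g_def x_def inj_on_def)
  have "0 \<le> minor q (\<lambda>i j. h (i + j) + t * g (i + j)) r c" if "0 < t" for t
    using hankel_minors_pos[OF psd_plus_pd[OF psd0 g0 that] psd_plus_pd[OF psd1 g1 that] rc]
    by simp
  then have "\<forall>\<^sub>F t in at_right 0. 0 \<le> minor q (\<lambda>i j. h (i + j) + t * g (i + j)) r c"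
    by (auto intro: eventually_at_rightI[of 0 1])
  moreover have "((\<lambda>t. minor q (\<lambda>i j. h (i + j) + t * g (i + j)) r c)
      \<longlongrightarrow> minor q (\<lambda>i j. h (i + j) + 0 * g (i + j)) r c) (at_right 0)"
    unfolding minor_leibniz by (intro tendsto_intros)
  ultimately have "0 \<le> minor q (\<lambda>i j. h (i + j) + 0 * g (i + j)) r c"
    by (intro tendsto_lowerbound) auto
  then show ?thesis by simp
qed

section \<open>Total non-negativity of Hankel matrices\<close>

lemma index_seq_pick:
  assumes "R \<subseteq> {..<m}"
  shows "index_seq (card R) m (pick R)"
  unfolding index_seq_def using assms pick_mono_le pick_in_set_le by blast

lemma pick_index_seq:
  assumes "index_seq k m r" "i < k"
  shows "pick (r ` {..<k}) i = r i"
proof -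
  have inj: "inj_on r {..<k}"
    by (rule inj_onI) (metis assms(1) index_seqD(1) lessThan_iff nat_neq_iff)
  have "{a \<in> r ` {..<k}. a < r i} = r ` {..<i}"
  proof (intro equalityI subsetI)
    fix a assume "a \<in> {a \<in> r ` {..<k}. a < r i}"
    then obtain j where j: "j < k" "a = r j" "r j < r i" by auto
    then have "j < i" using index_seqD(1)[OF assms(1), of i j] by (metis less_asym nat_neq_iff)
    then show "a \<in> r ` {..<i}" using j by auto
  next
    fix a assume "a \<in> r ` {..<i}"
    then show "a \<in> {a \<in> r ` {..<k}. a < r i}"
      using assms(2) index_seqD(1)[OF assms(1)] by auto
  qed
  moreover have "card (r ` {..<i}) = i"
    using card_image[OF inj_on_subset[OF inj]] assms(2) by (metis card_lessThan lessThan_subset_iff less_imp_le)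
  ultimately show ?thesis using pick_card_in_set[of "r i" "r ` {..<k}"] assms(2) by simp
qed

lemma totally_nonneg_iff_minors:
  assumes A: "A \<in> carrier_mat m m"
  shows "totally_nonneg A \<longleftrightarrow>
    (\<forall>k r c. index_seq k m r \<longrightarrow> index_seq k m c \<longrightarrow> 0 \<le> minor k (\<lambda>i j. A $$ (i, j)) r c)"
proof -
  have sub: "submatrix A R C = mat (card R) (card C) (\<lambda>(i, j). A $$ (pick R i, pick C j))"
    if "R \<subseteq> {..<m}" "C \<subseteq> {..<m}" for R C
  proof -
    have "{i. i < m \<and> i \<in> R} = R" "{i. i < m \<and> i \<in> C} = C" using that by auto
    then show ?thesis using A by (simp add: submatrix_def)
  qed
  show ?thesis
  proof (intro iffI allI impI)
    fix k r c assume tn: "totally_nonneg A" and r: "index_seq k m r" and c: "index_seq k m c"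
    have card: "card (r ` {..<k}) = k" if "index_seq k m r" for r
      by (subst card_image)
        (auto intro!: inj_onI, metis that index_seqD(1) nat_neq_iff)
    have range: "r ` {..<k} \<subseteq> {..<m}" if "index_seq k m r" for r
      using index_seqD(2)[OF that] by auto
    have "0 \<le> det (submatrix A (r ` {..<k}) (c ` {..<k}))"
      using tn A card[OF r] card[OF c] range[OF r] range[OF c] by (auto simp: totally_nonneg_def)
    also have "submatrix A (r ` {..<k}) (c ` {..<k}) = mat k k (\<lambda>(i, j). A $$ (r i, c j))"
      unfolding sub[OF range[OF r] range[OF c]] card[OF r] card[OF c]
      by (rule eq_matI) (auto simp: pick_index_seq[OF r] pick_index_seq[OF c])
    finally show "0 \<le> minor k (\<lambda>i j. A $$ (i, j)) r c" by (simp add: minor_def)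
  next
    assume nn: "\<forall>k r c. index_seq k m r \<longrightarrow> index_seq k m c \<longrightarrow> 0 \<le> minor k (\<lambda>i j. A $$ (i, j)) r c"
    show "totally_nonneg A"
      unfolding totally_nonneg_def
    proof (intro allI impI, elim conjE)
      fix R C assume RC: "R \<subseteq> {..<dim_row A}" "C \<subseteq> {..<dim_col A}" and card: "card R = card C"
      have R: "R \<subseteq> {..<m}" and C: "C \<subseteq> {..<m}" using RC A by auto
      have "0 \<le> minor (card R) (\<lambda>i j. A $$ (i, j)) (pick R) (pick C)"
        using nn index_seq_pick[OF R] index_seq_pick[OF C] card by simp
      then show "0 \<le> det (submatrix A R C)"
        by (simp add: sub[OF R C] minor_def card)
    qed
  qed
qed

text \<open>
  The criterion that replaces all minors by two quadratic forms. Both forms come from minors of \<open>A\<close>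
  itself: a principal minor of the shifted matrix is a minor of \<open>A\<close> with columns moved by one.
\<close>
lemma hankel_totally_nonneg_iff:
  assumes A: "A \<in> carrier_mat m m" and h: "\<And>i j. i < m \<Longrightarrow> j < m \<Longrightarrow> A $$ (i, j) = h (i + j)"
  shows "totally_nonneg A \<longleftrightarrow> psd m (\<lambda>i j. h (i + j)) \<and> psd (m - 1) (\<lambda>i j. h (i + j + 1))"
proof
  assume "totally_nonneg A"
  then have nn: "0 \<le> minor k (\<lambda>i j. A $$ (i, j)) r c" if "index_seq k m r" "index_seq k m c" for k r c
    using that totally_nonneg_iff_minors[OF A] by blast
  have "psd m (\<lambda>i j. h (i + j))"
  proof (rule psd_of_principal_minors)
    fix k r assume r: "index_seq k m r"
    have "minor k (\<lambda>i j. A $$ (i, j)) r r = minor k (\<lambda>i j. h (i + j)) r r"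
      by (rule minor_cong) (simp add: h index_seqD(2)[OF r])
    then show "0 \<le> minor k (\<lambda>i j. h (i + j)) r r" using nn[OF r r] by simp
  qed (simp add: add.commute)
  moreover have "psd (m - 1) (\<lambda>i j. h (i + j + 1))"
  proof (rule psd_of_principal_minors)
    fix k r assume r: "index_seq k (m - 1) r"
    have r': "r i < m" "Suc (r i) < m" if "i < k" for i
      using index_seqD(2)[OF r that] by linarith+
    then have seqs: "index_seq k m r" "index_seq k m (Suc \<circ> r)"
      using index_seqD(1)[OF r] by (auto simp: index_seq_def)
    have "minor k (\<lambda>i j. A $$ (i, j)) r (Suc \<circ> r) = minor k (\<lambda>i j. h (i + j + 1)) r r"
      by (rule minor_cong) (simp add: h r')
    then show "0 \<le> minor k (\<lambda>i j. h (i + j + 1)) r r" using nn[OF seqs] by simp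
  qed (simp add: add.commute)
  ultimately show "psd m (\<lambda>i j. h (i + j)) \<and> psd (m - 1) (\<lambda>i j. h (i + j + 1))" ..
next
  assume psd: "psd m (\<lambda>i j. h (i + j)) \<and> psd (m - 1) (\<lambda>i j. h (i + j + 1))"
  show "totally_nonneg A"
    unfolding totally_nonneg_iff_minors[OF A]
  proof (intro allI impI)
    fix k r c assume r: "index_seq k m r" and c: "index_seq k m c"
    have "minor k (\<lambda>i j. A $$ (i, j)) r c = minor k (\<lambda>i j. h (i + j)) r c"
      by (rule minor_cong) (simp add: h index_seqD(2)[OF r] index_seqD(2)[OF c])
    then show "0 \<le> minor k (\<lambda>i j. A $$ (i, j)) r c"
      using hankel_minors_nonneg[of m h k r c] psd r c by simp
  qed
qed

text \<open>
  Entrywise application keeps the Hankel form, so positive semidefiniteness need only be preserved for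
  the two matrices in the criterion.
\<close>
lemma preserves_HTN_of_psd:
  assumes "\<And>m B. m \<le> N \<Longrightarrow> psd m B \<Longrightarrow> \<forall>i<m. \<forall>j<m. B i j \<in> I \<Longrightarrow> psd m (\<lambda>i j. f (B i j))"
  shows "preserves_HTN f N I"
  unfolding preserves_HTN_def
proof
  fix A assume "A \<in> HTN N I"
  then have A: "A \<in> carrier_mat N N" and hank: "hankel A" and tn: "totally_nonneg A"
    and el: "elements_mat A \<subseteq> I" by (auto simp: HTN_def)
  (* Runs down the first column to the corner block and then along the last row, so that every
     index stays in range. *)
  define h where "h k = A $$ (min k (N - 1), k - min k (N - 1))" for k
  have h: "A $$ (i, j) = h (i + j)" if "i < N" "j < N" for i j
  proof -
    let ?k = "min (i + j) (N - 1)"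
    have "?k < N" "i + j - ?k < N" "i + j = ?k + (i + j - ?k)" using that by auto
    moreover have "dim_row A = N" "dim_col A = N" using A by auto
    ultimately show ?thesis using hank that unfolding hankel_def h_def by metis
  qed
  have psd: "psd N (\<lambda>i j. h (i + j))" "psd (N - 1) (\<lambda>i j. h (i + j + 1))"
    using tn hankel_totally_nonneg_iff[OF A h] by auto
  (* The two matrices have all their entries among those of A. *)
  have ent: "h (i + j) \<in> I" if "i < N" "j < N" for i j
    using elements_matI[OF A that h[OF that, symmetric]] el by auto
  have "psd N (\<lambda>i j. f (h (i + j)))"
    by (rule assms[OF _ psd(1)]) (use ent in auto)
  moreover have "psd (N - 1) (\<lambda>i j. f (h (i + j + 1)))"
  proof (rule assms[OF _ psd(2)])
    show "\<forall>i<N - 1. \<forall>j<N - 1. h (i + j + 1) \<in> I"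
      using ent[of "Suc i" j for i j] by (auto simp: less_diff_conv)
  qed simp
  ultimately show "totally_nonneg (map_mat f A)"
    using hankel_totally_nonneg_iff[of "map_mat f A" N "\<lambda>k. f (h k)"] A h by simp
qed

section \<open>Power series with prescribed signs\<close>

text \<open>
  The base polynomial is split with weights \<open>(1/2) ^ Suc k\<close>, of total at most 1, among the other terms:
  its \<open>k\<close>-th share absorbs the \<open>k\<close>-th term, even when the coefficient is negative.
\<close>
lemma power_series_psd:
  fixes a c :: "nat \<Rightarrow> real" and f :: "real \<Rightarrow> real"
  assumes f: "\<And>x. x \<in> I \<Longrightarrow> (\<lambda>k. a k * x ^ k) sums f x"
    and "finite E" and aE: "\<And>k. k \<in> E \<Longrightarrow> a k = c k"
    and small: "\<And>k. k \<notin> E \<Longrightarrow> \<bar>a k\<bar> \<le> \<delta> k * (1/2) ^ Suc k"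
    and dom: "\<And>k. k \<notin> E \<Longrightarrow> a k \<noteq> 0 \<Longrightarrow> psd m (\<lambda>i j. (\<Sum>l\<in>E. c l * B i j ^ l) - \<delta> k * B i j ^ k)"
    and base: "psd m (\<lambda>i j. \<Sum>l\<in>E. c l * B i j ^ l)"
    and B: "psd m B" "\<forall>i<m. \<forall>j<m. B i j \<in> I"
  shows "psd m (\<lambda>i j. f (B i j))"
proof -
  have "0 \<le> quad m (\<lambda>i j. f (B i j)) v" for v
  proof -
    define q where "q k = quad m (\<lambda>i j. B i j ^ k) v" for k
    have q: "q k \<ge> 0" for k using psd_power[OF B(1)] by (simp add: q_def psd_def)
    define q0 where "q0 = (\<Sum>l\<in>E. c l * q l)"
    have q0: "q0 \<ge> 0"
      using base unfolding psd_def q0_def q_def quad_sum by blast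
    have "(\<lambda>k. \<Sum>i<m. \<Sum>j<m. v i * v j * (a k * B i j ^ k)) sums quad m (\<lambda>i j. f (B i j)) v"
      unfolding quad_def by (intro sums_sum sums_mult f) (use B in auto)
    moreover have "(\<Sum>i<m. \<Sum>j<m. v i * v j * (a k * B i j ^ k)) = a k * q k" for k
      by (simp add: q_def quad_def sum_distrib_left mult_ac)
    ultimately have S: "(\<lambda>k. a k * q k) sums quad m (\<lambda>i j. f (B i j)) v" by simp
    have "(\<lambda>k. if k \<in> E then c k * q k else 0) sums q0"
      unfolding q0_def by (rule sums_If_finite_set) (rule assms(2))
    moreover have "(\<lambda>k. q0 * (1/2) ^ Suc k) sums (q0 * 1)"
      by (intro sums_mult power_half_series)
    ultimately have T: "(\<lambda>k. (if k \<in> E then c k * q k else 0) - q0 * (1/2) ^ Suc k) sums (q0 - q0 * 1)"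
      by (rule sums_diff)
    have "(if k \<in> E then c k * q k else 0) - q0 * (1/2) ^ Suc k \<le> a k * q k" for k
    proof (cases "k \<in> E \<or> a k = 0")
      case True
      have "0 \<le> q0 * (1/2) ^ Suc k" using q0 by simp
      then show ?thesis using True aE[of k] by auto
    next
      case False
      then have "psd m (\<lambda>i j. (\<Sum>l\<in>E. c l * B i j ^ l) + (- \<delta> k) * B i j ^ k)"
        using dom[of k] by simp
      then have "0 \<le> quad m (\<lambda>i j. (\<Sum>l\<in>E. c l * B i j ^ l) + (- \<delta> k) * B i j ^ k) v"
        by (simp add: psd_def)
      then have "\<delta> k * q k \<le> q0"
        unfolding quad_add quad_sum quad_scale by (simp add: q0_def q_def)
      have "\<bar>a k\<bar> * q k \<le> \<delta> k * (1/2) ^ Suc k * q k"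
        using small[of k] False q by (intro mult_right_mono) auto
      also have "\<dots> = (\<delta> k * q k) * (1/2) ^ Suc k" by simp
      also have "\<dots> \<le> q0 * (1/2) ^ Suc k"
        using \<open>\<delta> k * q k \<le> q0\<close> by (rule mult_right_mono) simp
      finally have "\<bar>a k\<bar> * q k \<le> q0 * (1/2) ^ Suc k" .
      moreover have "- (\<bar>a k\<bar> * q k) \<le> a k * q k"
        using mult_right_mono[OF abs_ge_minus_self[of "a k"] q[of k]] by (metis minus_le_iff mult_minus_left)
      ultimately have "- (q0 * (1/2) ^ Suc k) \<le> a k * q k" by linarith
      then show ?thesis using False by simp
    qed
    from sums_le[OF this T S] show ?thesis by simp
  qed
  then show ?thesis using B by (simp add: psd_def)
qed

theorem theorem9p8:
  fixes N :: nat and n :: "nat \<Rightarrow> nat" and \<epsilon> :: "nat \<Rightarrow> int"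
    and \<rho> :: real and c :: "nat \<Rightarrow> real"
  assumes "N > 0"
    and "strict_mono_on {..<N} n"
    and "\<And>M. M > n (N - 1) \<Longrightarrow> \<epsilon> M \<in> {-1, 0, 1}"
    and "\<rho> > 0"
    and "\<And>j. j < N \<Longrightarrow> c (n j) > 0"
  shows "\<exists>(f :: real \<Rightarrow> real) (a :: nat \<Rightarrow> real).
           (\<forall>x \<in> {0<..<\<rho>}. (\<lambda>k. a k * x ^ k) sums f x) \<and>
           (\<forall>j < N. a (n j) = c (n j)) \<and>
           (\<forall>k \<le> n (N - 1). k \<notin> n ` {..<N} \<longrightarrow> a k = 0) \<and>
           preserves_HTN f N {0<..<\<rho>} \<and>
           (\<forall>M > n (N - 1). sgn (a M) = of_int (\<epsilon> M))"
proof -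
  define E where "E = n ` {..<N}"
  define L where "L = n (N - 1)"
  have finE: "finite E" by (simp add: E_def)
  have cardE: "card E = N"
    unfolding E_def using card_image[OF strict_mono_on_imp_inj_on[OF assms(2)]] by simp
  have EL: "k \<le> L" if "k \<in> E" for k
  proof -
    obtain j where j: "j < N" "k = n j" using \<open>k \<in> E\<close> by (auto simp: E_def)
    show ?thesis
    proof (cases "j = N - 1")
      case False
      then have "j < N - 1" using j by simp
      then show ?thesis
        using strict_mono_onD[OF assms(2), of j "N - 1"] assms(1) j by (simp add: L_def)
    qed (simp add: j L_def)
  qed
  have cE: "c k > 0" if "k \<in> E" for k using that assms(5) by (auto simp: E_def)
  define tolerates where "tolerates M m \<delta> \<longleftrightarrow> (\<forall>B. psd m B \<longrightarrow> (\<forall>i<m. \<forall>j<m. B i j \<in> {0<..<\<rho>}) \<longrightarrow>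
      psd m (\<lambda>i j. (\<Sum>k\<in>E. c k * B i j ^ k) - \<delta> * B i j ^ M))" for M m \<delta>
  have "\<exists>\<delta>>0. \<forall>m\<le>N. tolerates M m \<delta>" if M: "M > L" for M
  proof -
    have "\<exists>\<delta>>0. tolerates M m \<delta>" if "m \<le> N" for m
      unfolding tolerates_def
    proof (rule power_domination[where c = c, OF assms(4) finE])
      show "k < M" if "k \<in> E" for k using EL[OF that] M by simp
    qed (use that cardE cE in auto)
    then obtain d where d: "\<And>m. m \<le> N \<Longrightarrow> d m > 0" "\<And>m. m \<le> N \<Longrightarrow> tolerates M m (d m)"
      by metis
    define \<delta> where "\<delta> = Min (d ` {..N})"
    have "\<delta> > 0" using d(1) by (auto simp: \<delta>_def)
    moreover have "tolerates M m \<delta>" if m: "m \<le> N" for m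
      unfolding tolerates_def
    proof (intro allI impI)
      fix B assume B: "psd m B" "\<forall>i<m. \<forall>j<m. B i j \<in> {0<..<\<rho>}"
      then have "psd m (\<lambda>i j. (\<Sum>k\<in>E. c k * B i j ^ k) - d m * B i j ^ M)"
        using d(2)[OF m] unfolding tolerates_def by blast
      moreover have "\<delta> \<le> d m" unfolding \<delta>_def using m by (intro Min_le) auto
      ultimately show "psd m (\<lambda>i j. (\<Sum>k\<in>E. c k * B i j ^ k) - \<delta> * B i j ^ M)"
        using psd_larger_coeff[OF _ B(1), where e = "- \<delta>"] by simp
    qed
    ultimately show ?thesis by blast
  qed
  then obtain \<delta> where \<delta>: "\<And>M. M > L \<Longrightarrow> \<delta> M > 0" "\<And>M m. M > L \<Longrightarrow> m \<le> N \<Longrightarrow> tolerates M m (\<delta> M)"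
    by metis
  (* The bound 1 / \<rho> ^ M makes the series converge on the whole interval. *)
  define s where "s M = min (\<delta> M) (1 / \<rho> ^ M) * (1/2) ^ Suc M" for M
  have s: "s M > 0" if "M > L" for M using \<delta>(1)[OF that] assms(4) by (simp add: s_def)
  define a where "a k = (if k \<in> E then c k else if k > L then of_int (\<epsilon> k) * s k else 0)" for k
  define f where "f x = (\<Sum>k. a k * x ^ k)" for x
  have a_abs: "\<bar>a k\<bar> \<le> s k" if "k > L" for k
  proof -
    have "k \<notin> E" using EL[of k] that by auto
    moreover have "\<epsilon> k \<in> {-1, 0, 1}" using assms(3) that by (simp add: L_def)
    ultimately show ?thesis using s[OF that] that by (auto simp: a_def abs_mult)
  qed
  have sums: "(\<lambda>k. a k * x ^ k) sums f x" if x: "x \<in> {0<..<\<rho>}" for x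
  proof -
    have "norm (a k * x ^ k) \<le> (1/2) ^ Suc k" if k: "k \<ge> Suc L" for k
    proof -
      have "\<bar>a k\<bar> * x ^ k \<le> s k * \<rho> ^ k"
        using a_abs[of k] s[of k] k x by (intro mult_mono power_mono) auto
      also have "\<dots> \<le> (1 / \<rho> ^ k * (1/2) ^ Suc k) * \<rho> ^ k"
        unfolding s_def using assms(4) by (intro mult_right_mono) auto
      also have "\<dots> = (1/2) ^ Suc k" using assms(4) by simp
      finally show ?thesis using x by (simp add: abs_mult)
    qed
    then have "summable (\<lambda>k. a k * x ^ k)"
      by (rule summable_comparison_test'[OF sums_summable[OF power_half_series]])
    then show ?thesis unfolding f_def by (rule summable_sums)
  qed
  have pres: "preserves_HTN f N {0<..<\<rho>}"
  proof (rule preserves_HTN_of_psd)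
    fix m B assume m: "m \<le> N" and B: "psd m B" "\<forall>i<m. \<forall>j<m. B i j \<in> {0<..<\<rho>}"
    have dominated: "psd m (\<lambda>i j. (\<Sum>k\<in>E. c k * B i j ^ k) - \<delta> M * B i j ^ M)" if "M > L" for M
      using \<delta>(2)[OF that m] B unfolding tolerates_def by blast
    show "psd m (\<lambda>i j. f (B i j))"
    proof (rule power_series_psd[where f = f and B = B and a = a and c = c and E = E and I = "{0<..<\<rho>}" and \<delta> = "\<lambda>k. if k > L then \<delta> k else 0"])
      show "\<bar>a k\<bar> \<le> (if k > L then \<delta> k else 0) * (1/2) ^ Suc k" if "k \<notin> E" for k
      proof (cases "k > L")
        case True
        have "s k \<le> \<delta> k * (1/2) ^ Suc k" unfolding s_def by (intro mult_right_mono) auto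
        then show ?thesis using a_abs[OF True] True by simp
      next
        case False
        then show ?thesis using that by (simp add: a_def)
      qed
      show "psd m (\<lambda>i j. (\<Sum>l\<in>E. c l * B i j ^ l) - (if k > L then \<delta> k else 0) * B i j ^ k)"
        if "k \<notin> E" "a k \<noteq> 0" for k
      proof -
        have "k > L" using that by (auto simp: a_def split: if_splits)
        then show ?thesis using dominated[of k] by simp
      qed
      show "psd m (\<lambda>i j. \<Sum>l\<in>E. c l * B i j ^ l)"
        using psd_larger_coeff[OF dominated[of "Suc L"] B(1), of 0] \<delta>(1)[of "Suc L"] by simp
    qed (use finE sums B in \<open>auto simp: a_def\<close>)
  qed
  have "sgn (a M) = of_int (\<epsilon> M)" if "M > L" for M
  proof -
    have "M \<notin> E" using EL[of M] that by auto
    moreover have "\<epsilon> M \<in> {-1, 0, 1}" using assms(3) that by (simp add: L_def)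
    ultimately show ?thesis using s[OF that] that by (auto simp: a_def sgn_mult)
  qed
  then show ?thesis
    using sums pres by (intro exI[of _ f] exI[of _ a]) (auto simp: a_def E_def L_def)
qed

end
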